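(* (a) In the generic extension of $V$ by Cohen forcing $\mathbb{C}$, the set $\{r \in \mathbb{R} : r \text{ is Cohen generic over } V\}$ has (Lebesgue) measure zero. (b) The set $\{r \in \mathbb{R} : r \text{ is a Liouville number}\}$ contains a perfect set.
   Context: Cohen forcing $\mathbb{C}$ is the set of functions $p : n \to 2$, $n \in \omega$, ordered by reverse inclusion. A real is Cohen generic over $V$ if it belongs to no meager Borel set coded in $V$; an element $r \in 2^\omega$ is viewed as the real number $\sum_i r(i)/2^{i+1}$. A Liouville number is a real number $r$ such that for every positive integer $n$ there exist infinitely many pairs of integers $(p,q)$ with $q > 1$ and $0 < |r - p/q| < 1/q^n$. *)

theory Defs
  imports "HOL-Analysis.Analysis"
begin

text \<open>
  Forcing is treated in the usual semantic way: the ground model is a transitive model \<open>V\<close> of ZFC,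
  \<open>G\<close> is a generic filter over \<open>V\<close>, and the generic extension \<open>V[G]\<close> is the set of values of the
  names in \<open>V\<close>. Transitive sets are represented, via the Mostowski collapse, by a type
  \<open>'u\<close> with a well-founded extensional relation \<open>E\<close> playing the role of membership; \<open>V\<close>
  and \<open>V[G]\<close> are transitive subsets of \<open>'u\<close>. The model \<open>V\<close> need not be countable.
\<close>


section \<open>Transitive models of ZFC\<close>

definition membership_relation :: "('u \<Rightarrow> 'u \<Rightarrow> bool) \<Rightarrow> bool" where
  "membership_relation E \<longleftrightarrow> wfP E \<and> (\<forall>x y. (\<forall>z. E z x \<longleftrightarrow> E z y) \<longrightarrow> x = y)"

definition transitive_in :: "('u \<Rightarrow> 'u \<Rightarrow> bool) \<Rightarrow> 'u set \<Rightarrow> bool" where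
  "transitive_in E M \<longleftrightarrow> (\<forall>x\<in>M. \<forall>z. E z x \<longrightarrow> z \<in> M)"

text \<open>First-order formulas in the language of set theory, with variables named by numbers.\<close>

datatype formula =
    Mem nat nat
  | Equ nat nat
  | Neg formula
  | Conj formula formula
  | Forall nat formula

primrec sat :: "('u \<Rightarrow> 'u \<Rightarrow> bool) \<Rightarrow> 'u set \<Rightarrow> (nat \<Rightarrow> 'u) \<Rightarrow> formula \<Rightarrow> bool" where
  "sat E M e (Mem i j) \<longleftrightarrow> E (e i) (e j)"
| "sat E M e (Equ i j) \<longleftrightarrow> e i = e j"
| "sat E M e (Neg \<phi>) \<longleftrightarrow> \<not> sat E M e \<phi>"
| "sat E M e (Conj \<phi> \<psi>) \<longleftrightarrow> sat E M e \<phi> \<and> sat E M e \<psi>"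
| "sat E M e (Forall i \<phi>) \<longleftrightarrow> (\<forall>x\<in>M. sat E M (e(i := x)) \<phi>)"

definition ZFC_model :: "('u \<Rightarrow> 'u \<Rightarrow> bool) \<Rightarrow> 'u set \<Rightarrow> bool" where
  "ZFC_model E M \<longleftrightarrow>
     \<comment> \<open>Extensionality\<close>
     (\<forall>x\<in>M. \<forall>y\<in>M. (\<forall>z\<in>M. E z x \<longleftrightarrow> E z y) \<longrightarrow> x = y) \<and>
     \<comment> \<open>Foundation\<close>
     (\<forall>x\<in>M. (\<exists>y\<in>M. E y x) \<longrightarrow> (\<exists>y\<in>M. E y x \<and> \<not> (\<exists>z\<in>M. E z x \<and> E z y))) \<and>
     \<comment> \<open>Pairing\<close>
     (\<forall>x\<in>M. \<forall>y\<in>M. \<exists>u\<in>M. \<forall>z\<in>M. E z u \<longleftrightarrow> z = x \<or> z = y) \<and>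
     \<comment> \<open>Union\<close>
     (\<forall>x\<in>M. \<exists>u\<in>M. \<forall>z\<in>M. E z u \<longleftrightarrow> (\<exists>y\<in>M. E y x \<and> E z y)) \<and>
     \<comment> \<open>Power set\<close>
     (\<forall>x\<in>M. \<exists>u\<in>M. \<forall>z\<in>M. E z u \<longleftrightarrow> (\<forall>w\<in>M. E w z \<longrightarrow> E w x)) \<and>
     \<comment> \<open>Infinity\<close>
     (\<exists>x\<in>M. (\<exists>z\<in>M. (\<forall>w\<in>M. \<not> E w z) \<and> E z x) \<and>
        (\<forall>y\<in>M. E y x \<longrightarrow> (\<exists>s\<in>M. E s x \<and> (\<forall>w\<in>M. E w s \<longleftrightarrow> E w y \<or> w = y)))) \<and>
     \<comment> \<open>Separation schema; the environment \<open>e\<close> supplies the parameters\<close>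
     (\<forall>\<phi> e. range e \<subseteq> M \<longrightarrow>
        (\<forall>a\<in>M. \<exists>b\<in>M. \<forall>z\<in>M. E z b \<longleftrightarrow> E z a \<and> sat E M (e(0 := z)) \<phi>)) \<and>
     \<comment> \<open>Replacement schema\<close>
     (\<forall>\<phi> e. range e \<subseteq> M \<longrightarrow>
        (\<forall>a\<in>M. (\<forall>x\<in>M. E x a \<longrightarrow> (\<exists>!y. y \<in> M \<and> sat E M (e(0 := x, 1 := y)) \<phi>)) \<longrightarrow>
           (\<exists>b\<in>M. \<forall>y\<in>M. E y b \<longleftrightarrow> (\<exists>x\<in>M. E x a \<and> sat E M (e(0 := x, 1 := y)) \<phi>)))) \<and>
     \<comment> \<open>Choice: every family of nonempty, pairwise disjoint sets has a transversal\<close>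
     (\<forall>a\<in>M. (\<forall>x\<in>M. E x a \<longrightarrow> (\<exists>z\<in>M. E z x)) \<and>
        (\<forall>x\<in>M. \<forall>y\<in>M. E x a \<and> E y a \<and> x \<noteq> y \<longrightarrow> \<not> (\<exists>z\<in>M. E z x \<and> E z y)) \<longrightarrow>
        (\<exists>c\<in>M. \<forall>x\<in>M. E x a \<longrightarrow> (\<exists>!z. z \<in> M \<and> E z c \<and> E z x)))"


section \<open>Numerals, pairs, functions and reals as sets\<close>

definition is_upair :: "('u \<Rightarrow> 'u \<Rightarrow> bool) \<Rightarrow> 'u \<Rightarrow> 'u \<Rightarrow> 'u \<Rightarrow> bool" where
  "is_upair E a b x \<longleftrightarrow> (\<forall>z. E z x \<longleftrightarrow> z = a \<or> z = b)"

definition is_opair :: "('u \<Rightarrow> 'u \<Rightarrow> bool) \<Rightarrow> 'u \<Rightarrow> 'u \<Rightarrow> 'u \<Rightarrow> bool" where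
  "is_opair E a b x \<longleftrightarrow> (\<exists>s t. is_upair E a a s \<and> is_upair E a b t \<and> is_upair E s t x)"

primrec is_numeral :: "('u \<Rightarrow> 'u \<Rightarrow> bool) \<Rightarrow> nat \<Rightarrow> 'u \<Rightarrow> bool" where
  "is_numeral E 0 x \<longleftrightarrow> (\<forall>z. \<not> E z x)"
| "is_numeral E (Suc n) x \<longleftrightarrow> (\<exists>y. is_numeral E n y \<and> (\<forall>z. E z x \<longleftrightarrow> E z y \<or> z = y))"

definition is_numeral_pair :: "('u \<Rightarrow> 'u \<Rightarrow> bool) \<Rightarrow> nat \<Rightarrow> nat \<Rightarrow> 'u \<Rightarrow> bool" where
  "is_numeral_pair E m n z \<longleftrightarrow> (\<exists>a b. is_numeral E m a \<and> is_numeral E n b \<and> is_opair E a b z)"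

text \<open>\<open>function_in E M f\<close> says \<open>f \<in> M\<close>, the function \<open>f\<close> being identified with its graph.\<close>

definition function_in :: "('u \<Rightarrow> 'u \<Rightarrow> bool) \<Rightarrow> 'u set \<Rightarrow> (nat \<Rightarrow> nat) \<Rightarrow> bool" where
  "function_in E M f \<longleftrightarrow> (\<exists>x\<in>M. \<forall>z. E z x \<longleftrightarrow> (\<exists>n. is_numeral_pair E n (f n) z))"

text \<open>The enumeration of the rationals is the explicit one from the library, so that it belongs
  to every transitive model.\<close>

definition ratr :: "nat \<Rightarrow> real" where
  "ratr n = of_rat (nat_to_rat_surj n)"

text \<open>A real number is represented by its Dedekind cut, as a set of indices of rationals.\<close>

definition is_real :: "('u \<Rightarrow> 'u \<Rightarrow> bool) \<Rightarrow> real \<Rightarrow> 'u \<Rightarrow> bool" where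
  "is_real E r x \<longleftrightarrow> (\<forall>z. E z x \<longleftrightarrow> (\<exists>n. ratr n < r \<and> is_numeral E n z))"

definition reals_of :: "('u \<Rightarrow> 'u \<Rightarrow> bool) \<Rightarrow> 'u set \<Rightarrow> real set" where
  "reals_of E M = {r. \<exists>x\<in>M. is_real E r x}"

text \<open>\<open>X\<close> is, in \<open>M\<close>, a sequence of sets of reals: the set of all pairs \<open>(n, r)\<close> with
  \<open>r \<in> X n\<close> is an element of \<open>M\<close>.\<close>

definition real_set_sequence_in ::
    "('u \<Rightarrow> 'u \<Rightarrow> bool) \<Rightarrow> 'u set \<Rightarrow> (nat \<Rightarrow> real set) \<Rightarrow> bool" where
  "real_set_sequence_in E M X \<longleftrightarrow>
     (\<forall>n. X n \<subseteq> reals_of E M) \<and>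
     (\<exists>x\<in>M. \<forall>z. E z x \<longleftrightarrow>
        (\<exists>n r a b. r \<in> X n \<and> is_numeral E n a \<and> is_real E r b \<and> is_opair E a b z))"


section \<open>Cohen forcing and its generic extension\<close>

definition cohen_condition :: "('u \<Rightarrow> 'u \<Rightarrow> bool) \<Rightarrow> 'u \<Rightarrow> bool" where
  "cohen_condition E p \<longleftrightarrow>
     (\<exists>n f. (\<forall>i<n. f i < (2::nat)) \<and> (\<forall>z. E z p \<longleftrightarrow> (\<exists>i<n. is_numeral_pair E i (f i) z)))"

definition cohen_forcing :: "('u \<Rightarrow> 'u \<Rightarrow> bool) \<Rightarrow> 'u set \<Rightarrow> 'u set" where
  "cohen_forcing E V = {p\<in>V. cohen_condition E p}"

definition stronger :: "('u \<Rightarrow> 'u \<Rightarrow> bool) \<Rightarrow> 'u \<Rightarrow> 'u \<Rightarrow> bool" where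
  "stronger E p q \<longleftrightarrow> (\<forall>z. E z q \<longrightarrow> E z p)"

definition dense_in_cohen :: "('u \<Rightarrow> 'u \<Rightarrow> bool) \<Rightarrow> 'u set \<Rightarrow> 'u \<Rightarrow> bool" where
  "dense_in_cohen E V D \<longleftrightarrow>
     (\<forall>d. E d D \<longrightarrow> d \<in> cohen_forcing E V) \<and>
     (\<forall>p\<in>cohen_forcing E V. \<exists>d. E d D \<and> stronger E d p)"

definition generic_filter :: "('u \<Rightarrow> 'u \<Rightarrow> bool) \<Rightarrow> 'u set \<Rightarrow> 'u set \<Rightarrow> bool" where
  "generic_filter E V G \<longleftrightarrow>
     G \<subseteq> cohen_forcing E V \<and> G \<noteq> {} \<and>
     (\<forall>p\<in>G. \<forall>q\<in>cohen_forcing E V. stronger E p q \<longrightarrow> q \<in> G) \<and>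
     (\<forall>p\<in>G. \<forall>q\<in>G. \<exists>s\<in>G. stronger E s p \<and> stronger E s q) \<and>
     (\<forall>D\<in>V. dense_in_cohen E V D \<longrightarrow> (\<exists>p\<in>G. E p D))"

inductive cohen_name :: "('u \<Rightarrow> 'u \<Rightarrow> bool) \<Rightarrow> 'u \<Rightarrow> bool" for E where
  "(\<And>z. E z \<tau> \<Longrightarrow> \<exists>\<sigma> p. is_opair E \<sigma> p z \<and> cohen_condition E p \<and> cohen_name E \<sigma>)
     \<Longrightarrow> cohen_name E \<tau>"

definition names_of :: "('u \<Rightarrow> 'u \<Rightarrow> bool) \<Rightarrow> 'u set \<Rightarrow> 'u set" where
  "names_of E V = {\<tau>\<in>V. cohen_name E \<tau>}"

text \<open>\<open>VG\<close> consists of the values of the names in \<open>V\<close>, where the value of \<open>\<tau>\<close> is the set of all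
  values of \<open>\<sigma>\<close> with \<open>(\<sigma>, p) \<in> \<tau>\<close> for some \<open>p \<in> G\<close>. As \<open>E\<close> is well-founded and
  extensional, this recursion determines \<open>val\<close> on the names, and hence \<open>VG\<close>, uniquely.\<close>

definition generic_extension ::
    "('u \<Rightarrow> 'u \<Rightarrow> bool) \<Rightarrow> 'u set \<Rightarrow> 'u set \<Rightarrow> 'u set \<Rightarrow> bool" where
  "generic_extension E V G VG \<longleftrightarrow>
     (\<exists>val. (\<forall>\<tau>\<in>names_of E V. \<forall>y. E y (val \<tau>) \<longleftrightarrow>
                (\<exists>\<sigma> p z. E z \<tau> \<and> is_opair E \<sigma> p z \<and> p \<in> G \<and> y = val \<sigma>)) \<and>
            VG = val ` names_of E V)"


section \<open>Cohen reals and measure zero\<close>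

text \<open>Borel codes in Baire space: \<open>c 0\<close> says whether the set coded by \<open>c\<close> is an open interval with
  rational endpoints, a complement, or a countable union. Being a Borel code, and the membership
  of a real in the coded set, are absolute for transitive models of ZFC; so the set coded by \<open>c\<close>
  in such a model \<open>M\<close> is the set of reals of \<open>M\<close> that lie in the set defined here.\<close>

inductive borel_code :: "(nat \<Rightarrow> nat) \<Rightarrow> real set \<Rightarrow> bool" where
  interval: "c 0 = 0 \<Longrightarrow> borel_code c {ratr (c 1)<..<ratr (c 2)}"
| complement: "c 0 = 1 \<Longrightarrow> borel_code (\<lambda>m. c (Suc m)) B \<Longrightarrow> borel_code c (- B)"
| union: "c 0 = 2 \<Longrightarrow> (\<And>n. borel_code (\<lambda>m. c (Suc (prod_encode (n, m)))) (B n))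
            \<Longrightarrow> borel_code c (\<Union>n. B n)"

text \<open>Meagerness as evaluated in \<open>M\<close>. Since the reals of \<open>M\<close> include all rationals, a set of reals
  of \<open>M\<close> is nowhere dense in the real line of \<open>M\<close> iff it is nowhere dense in the real line.\<close>

definition meager_in :: "('u \<Rightarrow> 'u \<Rightarrow> bool) \<Rightarrow> 'u set \<Rightarrow> real set \<Rightarrow> bool" where
  "meager_in E M A \<longleftrightarrow>
     (\<exists>X. real_set_sequence_in E M X \<and> (\<forall>n. interior (closure (X n)) = {}) \<and> A \<subseteq> (\<Union>n. X n))"

definition cohen_generic_over :: "('u \<Rightarrow> 'u \<Rightarrow> bool) \<Rightarrow> 'u set \<Rightarrow> real \<Rightarrow> bool" where
  "cohen_generic_over E V r \<longleftrightarrow>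
     \<not> (\<exists>c B. function_in E V c \<and> borel_code c B \<and> meager_in E V (B \<inter> reals_of E V) \<and> r \<in> B)"

text \<open>Lebesgue measure zero as evaluated in \<open>M\<close>: the covering sequences of intervals are elements
  of \<open>M\<close>.\<close>

definition measure_zero_in :: "('u \<Rightarrow> 'u \<Rightarrow> bool) \<Rightarrow> 'u set \<Rightarrow> real set \<Rightarrow> bool" where
  "measure_zero_in E M A \<longleftrightarrow>
     (\<forall>\<epsilon>>0. \<exists>a b. function_in E M a \<and> function_in E M b \<and>
        (\<forall>n. ratr (a n) \<le> ratr (b n)) \<and>
        A \<subseteq> (\<Union>n. {ratr (a n)<..<ratr (b n)}) \<and>
        (\<forall>N. (\<Sum>n<N. ratr (b n) - ratr (a n)) \<le> \<epsilon>))"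


section \<open>Liouville numbers and perfect sets\<close>

definition liouville_number :: "real \<Rightarrow> bool" where
  "liouville_number r \<longleftrightarrow>
     (\<forall>n::nat. n > 0 \<longrightarrow>
        infinite {(p::int, q::int). q > 1 \<and>
          0 < \<bar>r - of_int p / of_int q\<bar> \<and> \<bar>r - of_int p / of_int q\<bar> < 1 / of_int q ^ n})"

definition perfect_set :: "real set \<Rightarrow> bool" where
  "perfect_set P \<longleftrightarrow> P \<noteq> {} \<and> closed P \<and> (\<forall>x\<in>P. x islimpt P)"

end

theory Submission
  imports Defs
begin

text \<open>
  (a) Surround the \<open>n\<close>-th rational by an open interval of length \<open>2 / (K (n + 1) (n + 2))\<close>. The union
  is open and dense with total length at most \<open>2 / K\<close>, and its complement is a closed nowhere dense
  set coded in \<open>V\<close>, so every Cohen real over \<open>V\<close> lies in the union. The endpoints are arithmetical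
  functions of \<open>n\<close>; hence they belong to \<open>V\<close> and, through names that only mention the trivial
  condition, to \<open>V[G]\<close>. To see that arithmetical objects belong
  to \<open>V\<close>, predicates on environments are called definable when they are expressed by a formula over
  \<open>V\<close>; closing these predicates under connectives, quantifiers, terms and recursion makes Separation
  and Replacement applicable without writing formulas.

  (b) The sums \<open>\<Sum>k. d\<^sub>k / 2 ^ fact k\<close> with \<open>d\<^sub>k \<in> {1, 2}\<close> are Liouville numbers, approximated by their
  partial sums. They form a continuous image of the Cantor space, without isolated points because
  changing the \<open>k\<close>-th digit moves the sum by exactly \<open>1 / 2 ^ fact k\<close>.
\<close>

section \<open>Definable predicates over a transitive model\<close>

primrec vars :: "formula \<Rightarrow> nat set" where
  "vars (Mem i j) = {i, j}"
| "vars (Equ i j) = {i, j}"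
| "vars (Neg \<phi>) = vars \<phi>"
| "vars (Conj \<phi> \<psi>) = vars \<phi> \<union> vars \<psi>"
| "vars (Forall i \<phi>) = insert i (vars \<phi>)"

primrec rename :: "(nat \<Rightarrow> nat) \<Rightarrow> formula \<Rightarrow> formula" where
  "rename \<rho> (Mem i j) = Mem (\<rho> i) (\<rho> j)"
| "rename \<rho> (Equ i j) = Equ (\<rho> i) (\<rho> j)"
| "rename \<rho> (Neg \<phi>) = Neg (rename \<rho> \<phi>)"
| "rename \<rho> (Conj \<phi> \<psi>) = Conj (rename \<rho> \<phi>) (rename \<rho> \<psi>)"
| "rename \<rho> (Forall i \<phi>) = Forall (\<rho> i) (rename \<rho> \<phi>)"

lemma finite_vars: "finite (vars \<phi>)"
  by (induction \<phi>) auto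

lemma sat_cong: "(\<And>i. i \<in> vars \<phi> \<Longrightarrow> e i = e' i) \<Longrightarrow> sat E M e \<phi> \<longleftrightarrow> sat E M e' \<phi>"
proof (induction \<phi> arbitrary: e e')
  case (Neg \<phi>)
  then show ?case by (metis sat.simps(3) vars.simps(3))
next
  case (Conj \<phi> \<psi>)
  from Conj.IH(1)[of e e'] Conj.IH(2)[of e e'] show ?case using Conj.prems by simp
next
  case (Forall i \<phi>)
  have "sat E M (e(i := x)) \<phi> \<longleftrightarrow> sat E M (e'(i := x)) \<phi>" for x
    by (rule Forall.IH) (use Forall.prems in auto)
  then show ?case by simp
qed auto

text \<open>\<open>vars\<close> counts bound variables too, so injectivity on it rules out capture:
  on the variables of the formula, updating \<open>e\<close> at \<open>\<rho> i\<close> and then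
  reading through \<open>\<rho>\<close> agrees with reading first and updating at
  \<open>i\<close>.\<close>

lemma sat_rename:
  "inj_on \<rho> (vars \<phi>) \<Longrightarrow> sat E M e (rename \<rho> \<phi>) \<longleftrightarrow> sat E M (\<lambda>i. e (\<rho> i)) \<phi>"
proof (induction \<phi> arbitrary: e)
  case (Conj \<phi> \<psi>)
  then show ?case by (simp add: inj_on_Un)
next
  case (Forall i \<phi>)
  have "sat E M (e(\<rho> i := x)) (rename \<rho> \<phi>) \<longleftrightarrow> sat E M ((\<lambda>i. e (\<rho> i))(i := x)) \<phi>" for x
  proof -
    have "sat E M (e(\<rho> i := x)) (rename \<rho> \<phi>) \<longleftrightarrow> sat E M (\<lambda>j. (e(\<rho> i := x)) (\<rho> j)) \<phi>"
      using Forall by (auto intro: inj_on_subset)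
    also have "\<dots> \<longleftrightarrow> sat E M ((\<lambda>i. e (\<rho> i))(i := x)) \<phi>"
      by (rule sat_cong) (use Forall.prems in \<open>auto simp: inj_on_def\<close>)
    finally show ?thesis .
  qed
  then show ?case by simp
qed auto

locale transitive_model =
  fixes E :: "'u \<Rightarrow> 'u \<Rightarrow> bool" and V :: "'u set"
  assumes membership: "membership_relation E"
    and transitive: "transitive_in E V"
    and ZFC: "ZFC_model E V"
begin

section \<open>The axioms with quantifiers freed by transitivity\<close>

lemma ext: "(\<And>z. E z x \<longleftrightarrow> E z y) \<Longrightarrow> x = y"
  using membership by (auto simp: membership_relation_def)

lemma wf: "wfP E"
  using membership by (auto simp: membership_relation_def)

lemma not_self: "\<not> E x x"
  using wf by (metis wfp_imp_irreflp irreflpD)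

lemma elem_in [dest]: "E z x \<Longrightarrow> x \<in> V \<Longrightarrow> z \<in> V"
  using transitive by (auto simp: transitive_in_def)

lemma pairing: "x \<in> V \<Longrightarrow> y \<in> V \<Longrightarrow> \<exists>u\<in>V. \<forall>z. E z u \<longleftrightarrow> z = x \<or> z = y"
proof -
  assume xy: "x \<in> V" "y \<in> V"
  from ZFC have "\<forall>x\<in>V. \<forall>y\<in>V. \<exists>u\<in>V. \<forall>z\<in>V. E z u \<longleftrightarrow> z = x \<or> z = y"
    unfolding ZFC_model_def by (elim conjE)
  then obtain u where "u \<in> V" "\<forall>z\<in>V. E z u \<longleftrightarrow> z = x \<or> z = y" using xy by blast
  then show ?thesis using xy by (intro bexI[of _ u]) blast+
qed

lemma union: "x \<in> V \<Longrightarrow> \<exists>u\<in>V. \<forall>z. E z u \<longleftrightarrow> (\<exists>y. E y x \<and> E z y)"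
proof -
  assume x: "x \<in> V"
  from ZFC have "\<forall>x\<in>V. \<exists>u\<in>V. \<forall>z\<in>V. E z u \<longleftrightarrow> (\<exists>y\<in>V. E y x \<and> E z y)"
    unfolding ZFC_model_def by (elim conjE)
  then obtain u where "u \<in> V" "\<forall>z\<in>V. E z u \<longleftrightarrow> (\<exists>y\<in>V. E y x \<and> E z y)" using x by blast
  then show ?thesis using x by (intro bexI[of _ u]) blast+
qed

text \<open>The quantifier over \<open>z\<close> stays bounded by \<open>V\<close>, since a subset
  of \<open>x\<close> need not belong to \<open>V\<close>; only the inner quantifier over elements
  is freed by transitivity.\<close>

lemma power_set: "x \<in> V \<Longrightarrow> \<exists>u\<in>V. \<forall>z\<in>V. E z u \<longleftrightarrow> (\<forall>w. E w z \<longrightarrow> E w x)"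
proof -
  assume x: "x \<in> V"
  from ZFC have "\<forall>x\<in>V. \<exists>u\<in>V. \<forall>z\<in>V. E z u \<longleftrightarrow> (\<forall>w\<in>V. E w z \<longrightarrow> E w x)"
    unfolding ZFC_model_def by (elim conjE)
  then obtain u where "u \<in> V" "\<forall>z\<in>V. E z u \<longleftrightarrow> (\<forall>w\<in>V. E w z \<longrightarrow> E w x)" using x by blast
  then show ?thesis using x by (intro bexI[of _ u]) blast+
qed

lemma infinity: "\<exists>x\<in>V. (\<exists>z. (\<forall>w. \<not> E w z) \<and> E z x) \<and>
    (\<forall>y. E y x \<longrightarrow> (\<exists>s. E s x \<and> (\<forall>w. E w s \<longleftrightarrow> E w y \<or> w = y)))"
proof -
  from ZFC have "\<exists>x\<in>V. (\<exists>z\<in>V. (\<forall>w\<in>V. \<not> E w z) \<and> E z x) \<and>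
        (\<forall>y\<in>V. E y x \<longrightarrow> (\<exists>s\<in>V. E s x \<and> (\<forall>w\<in>V. E w s \<longleftrightarrow> E w y \<or> w = y)))"
    unfolding ZFC_model_def by (elim conjE)
  then obtain x where x: "x \<in> V" "\<exists>z\<in>V. (\<forall>w\<in>V. \<not> E w z) \<and> E z x"
      "\<forall>y\<in>V. E y x \<longrightarrow> (\<exists>s\<in>V. E s x \<and> (\<forall>w\<in>V. E w s \<longleftrightarrow> E w y \<or> w = y))" by blast
  have "\<exists>s. E s x \<and> (\<forall>w. E w s \<longleftrightarrow> E w y \<or> w = y)" if "E y x" for y
    using x(1,3) that by (metis elem_in)
  with x(1,2) show ?thesis by (intro bexI[of _ x]) blast+
qed

lemma env_in: "range e \<subseteq> V \<Longrightarrow> e i \<in> V"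
  by auto

text \<open>One formula has to serve all environments over \<open>V\<close>; parameters are simply
  values of the environment.\<close>

definition definable :: "((nat \<Rightarrow> 'u) \<Rightarrow> bool) \<Rightarrow> bool" where
  "definable P \<longleftrightarrow> (\<exists>\<phi>. \<forall>e. range e \<subseteq> V \<longrightarrow> (sat E V e \<phi> \<longleftrightarrow> P e))"

lemma definable_cong:
  "definable P \<Longrightarrow> (\<And>e. range e \<subseteq> V \<Longrightarrow> P e \<longleftrightarrow> Q e) \<Longrightarrow> definable Q"
proof -
  assume P: "definable P" and eq: "\<And>e. range e \<subseteq> V \<Longrightarrow> P e \<longleftrightarrow> Q e"
  from P obtain \<phi> where "\<forall>e. range e \<subseteq> V \<longrightarrow> (sat E V e \<phi> \<longleftrightarrow> P e)"
    unfolding definable_def ..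
  then show "definable Q" unfolding definable_def by (intro exI[of _ \<phi>]) (simp add: eq)
qed

lemma definable_mem: "definable (\<lambda>e. E (e i) (e j))"
  unfolding definable_def by (intro exI[of _ "Mem i j"]) simp

lemma definable_equ: "definable (\<lambda>e. e i = e j)"
  unfolding definable_def by (intro exI[of _ "Equ i j"]) simp

lemma definable_not: "definable P \<Longrightarrow> definable (\<lambda>e. \<not> P e)"
proof -
  assume "definable P"
  then obtain \<phi> where "\<forall>e. range e \<subseteq> V \<longrightarrow> (sat E V e \<phi> \<longleftrightarrow> P e)"
    unfolding definable_def ..
  then show ?thesis unfolding definable_def by (intro exI[of _ "Neg \<phi>"]) simp
qed

lemma definable_conj: "definable P \<Longrightarrow> definable Q \<Longrightarrow> definable (\<lambda>e. P e \<and> Q e)"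
proof -
  assume "definable P" "definable Q"
  then obtain \<phi> \<psi> where "\<forall>e. range e \<subseteq> V \<longrightarrow> (sat E V e \<phi> \<longleftrightarrow> P e)"
      "\<forall>e. range e \<subseteq> V \<longrightarrow> (sat E V e \<psi> \<longleftrightarrow> Q e)"
    unfolding definable_def by (elim exE)
  then show ?thesis unfolding definable_def by (intro exI[of _ "Conj \<phi> \<psi>"]) simp
qed

lemma definable_disj:
  assumes "definable P" "definable Q"
  shows "definable (\<lambda>e. P e \<or> Q e)"
  using definable_not[OF definable_conj[OF definable_not[OF assms(1)] definable_not[OF assms(2)]]]
  by simp

lemma definable_imp:
  assumes "definable P" "definable Q"
  shows "definable (\<lambda>e. P e \<longrightarrow> Q e)"
  using definable_disj[OF definable_not[OF assms(1)] assms(2)] by simp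

lemma definable_iff:
  assumes "definable P" "definable Q"
  shows "definable (\<lambda>e. P e \<longleftrightarrow> Q e)"
  using definable_conj[OF definable_imp[OF assms] definable_imp[OF assms(2,1)]]
  by (rule definable_cong) iprover

text \<open>Bound variables are handled in de Bruijn style: \<open>e 0\<close> is the innermost one, and the
  environment outside the quantifier is \<open>\<lambda>i. e (Suc i)\<close>.\<close>

lemma definable_ball:
  assumes "definable (\<lambda>e. P (e 0) (\<lambda>i. e (Suc i)))"
  shows "definable (\<lambda>e. \<forall>x\<in>V. P x e)"
proof -
  obtain \<phi> where \<phi>: "\<And>e. range e \<subseteq> V \<Longrightarrow> sat E V e \<phi> \<longleftrightarrow> P (e 0) (\<lambda>i. e (Suc i))"
    using assms unfolding definable_def by blast
  \<comment> \<open>\<open>K\<close> exceeds every variable of the formula, so it can serve as the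
    bound variable; \<open>\<rho>\<close> sends variable 0 to \<open>K\<close> and lowers the others
    by one, turning de Bruijn positions into named ones.\<close>
  obtain K where K: "\<And>i. i \<in> vars \<phi> \<Longrightarrow> i < K"
    using finite_vars[of \<phi>] finite_nat_set_iff_bounded by auto
  define \<rho> where "\<rho> i = (case i of 0 \<Rightarrow> K | Suc j \<Rightarrow> j)" for i
  have inj: "inj_on \<rho> (vars \<phi>)"
    using K unfolding inj_on_def \<rho>_def by (fastforce split: nat.splits)
  have "sat E V (e(K := x)) (rename \<rho> \<phi>) \<longleftrightarrow> P x e" if e: "range e \<subseteq> V" and x: "x \<in> V" for e x
  proof -
    have "sat E V (e(K := x)) (rename \<rho> \<phi>) \<longleftrightarrow> sat E V (\<lambda>i. (e(K := x)) (\<rho> i)) \<phi>"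
      by (rule sat_rename[OF inj])
    also have "\<dots> \<longleftrightarrow> sat E V (case_nat x e) \<phi>"
      by (rule sat_cong) (auto simp: \<rho>_def split: nat.splits dest: K)
    also have "\<dots> \<longleftrightarrow> P x e"
    proof -
      have "range (case_nat x e) \<subseteq> V"
        using e x by (auto simp: image_subset_iff split: nat.splits)
      then show ?thesis using \<phi>[of "case_nat x e"] by simp
    qed
    finally show ?thesis .
  qed
  then show ?thesis
    unfolding definable_def by (intro exI[of _ "Forall K (rename \<rho> \<phi>)"]) simp
qed

lemma definable_bex:
  assumes "definable (\<lambda>e. P (e 0) (\<lambda>i. e (Suc i)))"
  shows "definable (\<lambda>e. \<exists>x\<in>V. P x e)"
  using definable_not[OF definable_ball[of "\<lambda>x e. \<not> P x e"]] definable_not[OF assms] by simp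

lemma definable_rename:
  assumes "definable P" "inj \<rho>"
  shows "definable (\<lambda>e. P (\<lambda>i. e (\<rho> i)))"
proof -
  obtain \<phi> where \<phi>: "\<And>e. range e \<subseteq> V \<Longrightarrow> sat E V e \<phi> \<longleftrightarrow> P e"
    using assms(1) unfolding definable_def by blast
  have "sat E V e (rename \<rho> \<phi>) \<longleftrightarrow> P (\<lambda>i. e (\<rho> i))" if "range e \<subseteq> V" for e
    using sat_rename[of \<rho> \<phi> E V e] assms(2) \<phi>[of "\<lambda>i. e (\<rho> i)"] that
    by (auto simp: inj_on_def inj_def image_subset_iff)
  then show ?thesis unfolding definable_def by blast
qed

text \<open>The language has no function symbols, so a term is given by its graph, with the value in
  variable 0 and the arguments moved up by one.\<close>

definition definable_term :: "((nat \<Rightarrow> 'u) \<Rightarrow> 'u) \<Rightarrow> bool" where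
  "definable_term t \<longleftrightarrow>
     (\<forall>e. range e \<subseteq> V \<longrightarrow> t e \<in> V) \<and> definable (\<lambda>e. e 0 = t (\<lambda>i. e (Suc i)))"

lemma definable_term_var: "definable_term (\<lambda>e. e i)"
  unfolding definable_term_def by (auto intro: definable_equ)

lemma definable_term_shift:
  assumes "definable_term t"
  shows "definable_term (\<lambda>e. t (\<lambda>i. e (Suc i)))"
proof -
  have "definable (\<lambda>e. e 0 = t (\<lambda>i. e (Suc i)))"
    using assms by (simp add: definable_term_def)
  \<comment> \<open>The renaming keeps the value at 0 and skips 1, which leaves room for the
    additional variable.\<close>
  then have "definable (\<lambda>e. e (case_nat 0 (\<lambda>i. Suc (Suc i)) 0)
      = t (\<lambda>i. e (case_nat 0 (\<lambda>i. Suc (Suc i)) (Suc i))))"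
    by (rule definable_rename) (auto simp: inj_def split: nat.splits)
  moreover have "t (\<lambda>i. e (Suc i)) \<in> V" if "range e \<subseteq> V" for e
    using assms that by (auto simp: definable_term_def image_subset_iff)
  ultimately show ?thesis unfolding definable_term_def by simp
qed

text \<open>The term is eliminated by an existential quantifier over its value, which lies in
  \<open>V\<close> by the definition of \<open>definable_term\<close>.\<close>

lemma definable_subst:
  assumes "definable (\<lambda>e. P (e 0) (\<lambda>i. e (Suc i)))" "definable_term t"
  shows "definable (\<lambda>e. P (t e) e)"
proof (rule definable_cong)
  show "definable (\<lambda>e. \<exists>x\<in>V. x = t e \<and> P x e)"
    using assms unfolding definable_term_def by (intro definable_bex definable_conj) auto
qed (use assms(2) in \<open>auto simp: definable_term_def\<close>)

lemma definable_subst1: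
  assumes "definable (\<lambda>e. R (e 0))" "definable_term t"
  shows "definable (\<lambda>e. R (t e))"
  by (rule definable_subst[where P = "\<lambda>x e. R x"]) (use assms in auto)

text \<open>Each substitution consumes variable 0. The two variables are swapped first so that
  \<open>s\<close> can be substituted before \<open>t\<close>; shifting \<open>s\<close> keeps it
  apart from the variable still awaiting \<open>t\<close>.\<close>

lemma definable_subst2:
  assumes R: "definable (\<lambda>e. R (e 0) (e 1))" and t: "definable_term t" and s: "definable_term s"
  shows "definable (\<lambda>e. R (t e) (s e))"
proof (rule definable_subst[OF _ t, where P = "\<lambda>x e. R x (s e)"])
  have "definable (\<lambda>e. R (e (case_nat 1 (case_nat 0 (\<lambda>i. Suc (Suc i))) 0))
      (e (case_nat 1 (case_nat 0 (\<lambda>i. Suc (Suc i))) 1)))"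
    by (rule definable_rename[OF R]) (auto simp: inj_def split: nat.splits)
  then show "definable (\<lambda>e. R (e 0) (s (\<lambda>i. e (Suc i))))"
    by (intro definable_subst[OF _ definable_term_shift[OF s], where P = "\<lambda>x e. R (e 0) x"]) simp
qed

lemma definable_subst3:
  assumes R: "definable (\<lambda>e. R (e 0) (e 1) (e 2))"
    and t: "definable_term t" and s: "definable_term s" and u: "definable_term u"
  shows "definable (\<lambda>e. R (t e) (s e) (u e))"
proof (rule definable_subst[OF _ t, where P = "\<lambda>x e. R x (s e) (u e)"])
  define \<rho> where "\<rho> = case_nat 2 (case_nat 1 (case_nat 0 (\<lambda>i. Suc (Suc (Suc i)))))"
  have \<rho>: "\<rho> 0 = 2" "\<rho> 1 = 1" "\<rho> 2 = 0" by (simp_all add: \<rho>_def numeral_2_eq_2)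
  have "definable (\<lambda>e. R (e (\<rho> 0)) (e (\<rho> 1)) (e (\<rho> 2)))"
    by (rule definable_rename[OF R]) (auto simp: inj_def \<rho>_def split: nat.splits)
  then have "definable (\<lambda>e. R (e 1) (e 0) (u (\<lambda>i. e (Suc (Suc i)))))"
    by (intro definable_subst[OF _ definable_term_shift[OF definable_term_shift[OF u]],
          where P = "\<lambda>x e. R (e 1) (e 0) x"]) (simp add: \<rho>[unfolded numeral_2_eq_2 One_nat_def] numeral_2_eq_2)
  then show "definable (\<lambda>e. R (e 0) (s (\<lambda>i. e (Suc i))) (u (\<lambda>i. e (Suc i))))"
    by (intro definable_subst[OF _ definable_term_shift[OF s],
          where P = "\<lambda>x e. R (e 0) x (u (\<lambda>i. e (Suc i)))"]) simp
qed

lemma definable_mem_terms: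
  "definable_term t \<Longrightarrow> definable_term s \<Longrightarrow> definable (\<lambda>e. E (t e) (s e))"
  by (rule definable_subst2[where R = E, OF definable_mem])

lemma definable_eq_terms:
  "definable_term t \<Longrightarrow> definable_term s \<Longrightarrow> definable (\<lambda>e. t e = s e)"
  by (rule definable_subst2[where R = "(=)", OF definable_equ])

lemma definable_term1:
  assumes "definable (\<lambda>e. e 0 = F (e 1))" "\<And>x. x \<in> V \<Longrightarrow> F x \<in> V" "definable_term t"
  shows "definable_term (\<lambda>e. F (t e))"
  unfolding definable_term_def
proof (intro conjI allI impI)
  show "definable (\<lambda>e. e 0 = F (t (\<lambda>i. e (Suc i))))"
    by (rule definable_subst2[OF assms(1) definable_term_var definable_term_shift[OF assms(3)]])
qed (use assms(2,3) in \<open>auto simp: definable_term_def\<close>)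

lemma definable_term2:
  assumes "definable (\<lambda>e. e 0 = F (e 1) (e 2))" "\<And>x y. x \<in> V \<Longrightarrow> y \<in> V \<Longrightarrow> F x y \<in> V"
    "definable_term t" "definable_term s"
  shows "definable_term (\<lambda>e. F (t e) (s e))"
  unfolding definable_term_def
proof (intro conjI allI impI)
  show "definable (\<lambda>e. e 0 = F (t (\<lambda>i. e (Suc i))) (s (\<lambda>i. e (Suc i))))"
    by (rule definable_subst3[OF assms(1) definable_term_var
          definable_term_shift[OF assms(3)] definable_term_shift[OF assms(4)]])
qed (use assms(2-) in \<open>auto simp: definable_term_def\<close>)

lemmas definable_intros =
  definable_not definable_conj definable_disj definable_imp definable_iff
  definable_ball definable_bex definable_mem_terms definable_eq_terms definable_term_var

section \<open>Separation and Replacement for definable predicates\<close>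

lemma separation:
  assumes P: "definable (\<lambda>e. P (e 0) (e 1))" and "a \<in> V" "p \<in> V"
  shows "\<exists>b\<in>V. \<forall>z. E z b \<longleftrightarrow> E z a \<and> P z p"
proof -
  obtain \<phi> where \<phi>: "\<And>e. range e \<subseteq> V \<Longrightarrow> sat E V e \<phi> \<longleftrightarrow> P (e 0) (e 1)"
    using P unfolding definable_def by blast
  from ZFC have "\<forall>\<phi> e. range e \<subseteq> V \<longrightarrow>
        (\<forall>a\<in>V. \<exists>b\<in>V. \<forall>z\<in>V. E z b \<longleftrightarrow> E z a \<and> sat E V (e(0 := z)) \<phi>)"
    unfolding ZFC_model_def by (elim conjE)
  \<comment> \<open>The constant environment places the parameter \<open>p\<close> at variable
    1.\<close>
  from this[rule_format, of "\<lambda>_. p" a \<phi>] obtain b where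
    b: "b \<in> V" "\<forall>z\<in>V. E z b \<longleftrightarrow> E z a \<and> sat E V ((\<lambda>_. p)(0 := z)) \<phi>"
    using assms by auto
  have "sat E V ((\<lambda>_. p)(0 := z)) \<phi> \<longleftrightarrow> P z p" if "z \<in> V" for z
    using \<phi>[of "(\<lambda>_. p)(0 := z)"] that \<open>p \<in> V\<close> by (auto simp: image_subset_iff)
  with b \<open>a \<in> V\<close> show ?thesis by blast
qed

lemma replacement:
  assumes F: "definable_term (\<lambda>e. F (e 0))" and a: "a \<in> V"
  shows "\<exists>b\<in>V. \<forall>z. E z b \<longleftrightarrow> (\<exists>x. E x a \<and> z = F x)"
proof -
  \<comment> \<open>The schema expects the argument in variable 0 and the value in variable 1,
    opposite to \<open>definable_term\<close>.\<close>
  define sw :: "nat \<Rightarrow> nat" where "sw = case_nat 1 (case_nat 0 (\<lambda>i. Suc (Suc i)))"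
  have sw: "sw 0 = 1" "sw 1 = 0" by (simp_all add: sw_def)
  have "definable (\<lambda>e. e 0 = F (e 1))" using F by (simp add: definable_term_def)
  then have "definable (\<lambda>e. e (sw 0) = F (e (sw 1)))"
    by (rule definable_rename) (auto simp: inj_def sw_def split: nat.splits)
  then obtain \<phi> where \<phi>: "\<And>e. range e \<subseteq> V \<Longrightarrow> sat E V e \<phi> \<longleftrightarrow> e 1 = F (e 0)"
    unfolding definable_def sw by blast
  from ZFC have *: "\<forall>\<phi> e. range e \<subseteq> V \<longrightarrow>
        (\<forall>a\<in>V. (\<forall>x\<in>V. E x a \<longrightarrow> (\<exists>!y. y \<in> V \<and> sat E V (e(0 := x, 1 := y)) \<phi>)) \<longrightarrow>
           (\<exists>b\<in>V. \<forall>y\<in>V. E y b \<longleftrightarrow> (\<exists>x\<in>V. E x a \<and> sat E V (e(0 := x, 1 := y)) \<phi>)))"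
    unfolding ZFC_model_def by (elim conjE)
  have FV: "F x \<in> V" if "x \<in> V" for x
    using F that unfolding definable_term_def by (elim conjE allE[of _ "\<lambda>_. x"]) auto
  have sat: "sat E V ((\<lambda>_. a)(0 := x, 1 := y)) \<phi> \<longleftrightarrow> y = F x" if "x \<in> V" "y \<in> V" for x y
    using \<phi>[of "(\<lambda>_. a)(0 := x, 1 := y)"] that a by (auto simp: image_subset_iff)
  have "\<exists>b\<in>V. \<forall>y\<in>V. E y b \<longleftrightarrow> (\<exists>x\<in>V. E x a \<and> sat E V ((\<lambda>_. a)(0 := x, 1 := y)) \<phi>)"
    by (rule *[rule_format]) (use a sat FV in \<open>auto simp: image_subset_iff\<close>)
  then obtain b where b: "b \<in> V"
    "\<And>y. y \<in> V \<Longrightarrow> E y b \<longleftrightarrow> (\<exists>x\<in>V. E x a \<and> sat E V ((\<lambda>_. a)(0 := x, 1 := y)) \<phi>)" by blast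
  have "E z b \<longleftrightarrow> (\<exists>x. E x a \<and> z = F x)" for z
  proof
    assume "E z b"
    then show "\<exists>x. E x a \<and> z = F x" using b sat by blast
  next
    assume "\<exists>x. E x a \<and> z = F x"
    then obtain x where "E x a" "z = F x" by blast
    moreover from this have "x \<in> V" using a by blast
    ultimately show "E z b" using b(2)[of z] sat[of x z] FV[of x] by blast
  qed
  with b(1) show ?thesis by blast
qed

end

section \<open>Pairs, numerals and recursion over the natural numbers\<close>

context transitive_model
begin

text \<open>Description operators turn the relational coding of sets into functions. They are under
  control only when the model supplies the set described, hence the membership hypotheses in the
  lemmas about them.\<close>

definition up :: "'u \<Rightarrow> 'u \<Rightarrow> 'u" where
  "up a b = (THE x. \<forall>z. E z x \<longleftrightarrow> z = a \<or> z = b)"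

definition op :: "'u \<Rightarrow> 'u \<Rightarrow> 'u" where
  "op a b = up (up a a) (up a b)"

definition ins :: "'u \<Rightarrow> 'u \<Rightarrow> 'u" where
  "ins a x = (THE w. \<forall>z. E z w \<longleftrightarrow> E z x \<or> z = a)"

primrec num :: "nat \<Rightarrow> 'u" where
  "num 0 = (THE x. \<forall>z. \<not> E z x)"
| "num (Suc n) = ins (num n) (num n)"

lemma the_set:
  assumes "\<forall>z. E z y \<longleftrightarrow> Q z"
  shows "(THE x. \<forall>z. E z x \<longleftrightarrow> Q z) = y"
  by (rule the_equality) (use assms in \<open>auto intro: ext\<close>)

lemma up_spec:
  assumes "a \<in> V" "b \<in> V"
  shows "up a b \<in> V \<and> (\<forall>z. E z (up a b) \<longleftrightarrow> z = a \<or> z = b)"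
proof -
  obtain u where u: "u \<in> V" "\<forall>z. E z u \<longleftrightarrow> z = a \<or> z = b" using pairing[OF assms] by blast
  from the_set[OF u(2)] have "up a b = u" by (simp only: up_def)
  with u show ?thesis by simp
qed

lemma up_in [simp, intro]: "a \<in> V \<Longrightarrow> b \<in> V \<Longrightarrow> up a b \<in> V"
  using up_spec by blast

lemma E_up [simp]: "a \<in> V \<Longrightarrow> b \<in> V \<Longrightarrow> E z (up a b) \<longleftrightarrow> z = a \<or> z = b"
  using up_spec by blast

lemma op_in [simp, intro]: "a \<in> V \<Longrightarrow> b \<in> V \<Longrightarrow> op a b \<in> V"
  by (auto simp: op_def)

lemma ins_spec:
  assumes "a \<in> V" "x \<in> V"
  shows "ins a x \<in> V \<and> (\<forall>z. E z (ins a x) \<longleftrightarrow> E z x \<or> z = a)"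
proof -
  \<comment> \<open>The union of \<open>{x, {a}}\<close> is \<open>x\<close> with \<open>a\<close>
    added.\<close>
  obtain u where u: "u \<in> V" "\<forall>z. E z u \<longleftrightarrow> (\<exists>y. E y (up x (up a a)) \<and> E z y)"
    using union[of "up x (up a a)"] assms by auto
  then have "\<forall>z. E z u \<longleftrightarrow> E z x \<or> z = a" using assms by auto
  with the_set[OF this] u(1) show ?thesis by (simp only: ins_def) simp
qed

lemma ins_in [simp, intro]: "a \<in> V \<Longrightarrow> x \<in> V \<Longrightarrow> ins a x \<in> V"
  using ins_spec by blast

lemma E_ins [simp]: "a \<in> V \<Longrightarrow> x \<in> V \<Longrightarrow> E z (ins a x) \<longleftrightarrow> E z x \<or> z = a"
  using ins_spec by blast

lemma zero_exists: "\<exists>x\<in>V. \<forall>z. \<not> E z x"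
  using infinity by blast

lemma not_E_num_0: "\<not> E z (num 0)"
  using zero_exists the_set[of _ "\<lambda>z. False"] by force

lemma num_in [simp, intro]: "num n \<in> V"
proof (induction n)
  case 0
  show ?case using zero_exists the_set[of _ "\<lambda>z. False"] by force
qed auto

declare num.simps [simp del]

lemma E_num: "E z (num n) \<longleftrightarrow> (\<exists>k<n. z = num k)"
  by (induction n) (auto simp: not_E_num_0 num.simps(2) less_Suc_eq)

text \<open>If \<open>m < n\<close>, then \<open>num m\<close> is an element of
  \<open>num n\<close>, so equality would make a set an element of itself.\<close>

lemma num_eq [simp]: "num m = num n \<longleftrightarrow> m = n"
  by (metis E_num linorder_neqE_nat not_self)

lemma E_num_num [simp]: "E (num m) (num n) \<longleftrightarrow> m < n"
  by (simp add: E_num)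

lemma is_numeral_iff: "is_numeral E n x \<longleftrightarrow> x = num n"
proof (induction n arbitrary: x)
  case 0
  show ?case using not_E_num_0 by (auto intro: ext)
next
  case (Suc n)
  show ?case by (auto simp: Suc num.simps(2) intro: ext)
qed

lemma is_upair_iff: "a \<in> V \<Longrightarrow> b \<in> V \<Longrightarrow> is_upair E a b x \<longleftrightarrow> x = up a b"
  unfolding is_upair_def by (auto intro: ext)

lemma is_opair_iff: "a \<in> V \<Longrightarrow> b \<in> V \<Longrightarrow> is_opair E a b x \<longleftrightarrow> x = op a b"
  unfolding is_opair_def op_def by (auto simp: is_upair_iff)

lemma is_numeral_pair_iff: "is_numeral_pair E m n z \<longleftrightarrow> z = op (num m) (num n)"
  unfolding is_numeral_pair_def by (simp add: is_numeral_iff is_opair_iff)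

text \<open>Both components lie in the second member of the Kuratowski pair, so transitivity applies
  twice. This lets the relational pairs in the evaluation of names be replaced by
  \<open>op\<close>.\<close>

lemma is_opair_in:
  assumes "is_opair E a b x" "x \<in> V"
  shows "a \<in> V" "b \<in> V"
proof -
  obtain s t where "E t x" "E a t" "E b t"
    using assms unfolding is_opair_def is_upair_def by auto
  then show "a \<in> V" "b \<in> V" using assms by blast+
qed

lemma up_eq:
  assumes "a \<in> V" "b \<in> V" "c \<in> V" "d \<in> V"
  shows "up a b = up c d \<longleftrightarrow> a = c \<and> b = d \<or> a = d \<and> b = c"
proof
  assume "up a b = up c d"
  then have "z = a \<or> z = b \<longleftrightarrow> z = c \<or> z = d" for z
    using E_up[of a b z] E_up[of c d z] assms by simp
  then show "a = c \<and> b = d \<or> a = d \<and> b = c" by metis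
qed (use assms in \<open>auto intro: ext\<close>)

lemma op_eq [simp]:
  assumes "a \<in> V" "b \<in> V" "c \<in> V" "d \<in> V"
  shows "op a b = op c d \<longleftrightarrow> a = c \<and> b = d"
  using assms unfolding op_def by (auto simp: up_eq)

text \<open>Supplies the finite graphs that decide the values of recursive functions.\<close>

lemma finite_subset_in:
  assumes "finite A" "A \<subseteq> V"
  shows "\<exists>x\<in>V. \<forall>z. E z x \<longleftrightarrow> z \<in> A"
  using assms
proof (induction A)
  case empty
  then show ?case using zero_exists by auto
next
  case (insert a A)
  then obtain x where x: "x \<in> V" "\<forall>z. E z x \<longleftrightarrow> z \<in> A" by auto
  then show ?case using insert.prems by (intro bexI[of _ "ins a x"]) auto
qed

lemma eq_iff:
  assumes "x \<in> V" "y \<in> V"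
  shows "x = y \<longleftrightarrow> (\<forall>z\<in>V. E z x \<longleftrightarrow> E z y)"
  using assms by (auto intro!: ext)

lemma definable_term_up:
  "definable_term t \<Longrightarrow> definable_term s \<Longrightarrow> definable_term (\<lambda>e. up (t e) (s e))"
proof (rule definable_term2[where F = up])
  have "definable (\<lambda>e. \<forall>z\<in>V. E z (e 0) \<longleftrightarrow> z = e 1 \<or> z = e 2)"
    by (intro definable_intros)
  then show "definable (\<lambda>e. e 0 = up (e 1) (e 2))"
    by (rule definable_cong) (simp add: env_in eq_iff)
qed auto

lemma definable_term_op:
  "definable_term t \<Longrightarrow> definable_term s \<Longrightarrow> definable_term (\<lambda>e. op (t e) (s e))"
  unfolding op_def by (intro definable_term_up)

lemma definable_term_ins:
  "definable_term t \<Longrightarrow> definable_term s \<Longrightarrow> definable_term (\<lambda>e. ins (t e) (s e))"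
proof (rule definable_term2[where F = ins])
  have "definable (\<lambda>e. \<forall>z\<in>V. E z (e 0) \<longleftrightarrow> E z (e 2) \<or> z = e 1)"
    by (intro definable_intros)
  then show "definable (\<lambda>e. e 0 = ins (e 1) (e 2))"
    by (rule definable_cong) (simp add: env_in eq_iff)
qed auto

lemma definable_term_num: "definable_term (\<lambda>e. num n)"
proof (induction n)
  case 0
  have "definable (\<lambda>e. \<forall>z\<in>V. \<not> E z (e 0))"
    by (intro definable_intros)
  then have "definable (\<lambda>e. e 0 = num 0)"
    by (rule definable_cong) (simp add: env_in eq_iff not_E_num_0)
  then show ?case by (simp add: definable_term_def)
next
  case (Suc n)
  then show ?case unfolding num.simps(2) by (intro definable_term_ins)
qed

lemmas term_intros =
  definable_term_var definable_term_up definable_term_op definable_term_ins definable_term_num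

section \<open>Defining the natural numbers inside the model\<close>

definition has_numerals :: "'u \<Rightarrow> bool" where
  "has_numerals w \<longleftrightarrow> E (num 0) w \<and> (\<forall>y\<in>V. E y w \<longrightarrow> E (ins y y) w)"

lemma definable_has_numerals: "definable (\<lambda>e. has_numerals (e i))"
  unfolding has_numerals_def by (intro definable_intros term_intros)

lemma has_numerals_num: "has_numerals w \<Longrightarrow> E (num n) w"
  by (induction n) (auto simp: has_numerals_def num.simps(2))

text \<open>A formula captures the externally defined numerals because \<open>E\<close> is
  well-founded outside the model. If some nonnumeral lay in every inductive set, take a minimal such
  \<open>m\<close>: it is neither zero nor a successor of another member, so deleting it leaves an
  inductive set, a contradiction.\<close>

lemma numeral_iff_inductive:
  assumes z: "z \<in> V"
  shows "z \<in> range num \<longleftrightarrow> (\<forall>w\<in>V. has_numerals w \<longrightarrow> E z w)"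
proof
  assume *: "\<forall>w\<in>V. has_numerals w \<longrightarrow> E z w"
  show "z \<in> range num"
  proof (rule ccontr)
    assume "z \<notin> range num"
    obtain I where I: "I \<in> V" "has_numerals I"
    proof -
      from infinity obtain I where I: "I \<in> V" "\<exists>z. (\<forall>w. \<not> E w z) \<and> E z I"
          "\<forall>y. E y I \<longrightarrow> (\<exists>s. E s I \<and> (\<forall>w. E w s \<longleftrightarrow> E w y \<or> w = y))" by blast
      have "E (num 0) I"
        using I(2) not_E_num_0 by (metis ext)
      moreover have "E (ins y y) I" if yI: "E y I" for y
      proof -
        from yI have "y \<in> V" using I(1) by blast
        obtain s where s: "E s I" "\<forall>w. E w s \<longleftrightarrow> E w y \<or> w = y" using I(3)[rule_format, OF yI] by blast
        have "s = ins y y" by (rule ext) (simp add: s(2) \<open>y \<in> V\<close>)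
        with s(1) show ?thesis by simp
      qed
      ultimately show thesis using that I(1) by (auto simp: has_numerals_def)
    qed
    \<comment> \<open>\<open>W\<close> will be the intersection of all inductive sets of the model,
      cut out of \<open>I\<close>.\<close>
    have "definable (\<lambda>e. \<forall>w\<in>V. has_numerals w \<longrightarrow> E (e 0) w)"
      by (intro definable_intros definable_has_numerals)
    from separation[of "\<lambda>z _. \<forall>w\<in>V. has_numerals w \<longrightarrow> E z w", OF this I(1) I(1)] obtain W
      where W: "W \<in> V" "\<And>z. E z W \<longleftrightarrow> E z I \<and> (\<forall>w\<in>V. has_numerals w \<longrightarrow> E z w)" by blast
    have indW: "has_numerals W"
      using W I by (auto simp: has_numerals_def)
    define B where "B = {y. E y W \<and> y \<notin> range num}"
    have "z \<in> B" using * \<open>z \<notin> range num\<close> W(1) indW by (auto simp: B_def)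
    from wfp_on_iff_ex_minimal[THEN iffD1, of UNIV E] wf \<open>z \<in> B\<close> obtain m
      where m: "m \<in> B" "\<And>y. E y m \<Longrightarrow> y \<notin> B" by (metis empty_iff subset_UNIV)
    have mV: "m \<in> V" using m(1) W(1) by (auto simp: B_def)
    have "definable (\<lambda>e. e 0 \<noteq> e 1)" by (intro definable_intros)
    from separation[of "\<lambda>y m. y \<noteq> m", OF this W(1) mV] obtain W'
      where W': "W' \<in> V" "\<And>z. E z W' \<longleftrightarrow> E z W \<and> z \<noteq> m" by blast
    have "E (ins y y) W'" if "E y W'" for y
    proof -
      have y: "E y W" "y \<in> V" using that W' by auto
      \<comment> \<open>A predecessor \<open>y\<close> of \<open>m\<close> would be an element of
        \<open>m\<close>, hence a numeral by minimality, which would make \<open>m\<close> a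
        numeral.\<close>
      have "ins y y \<noteq> m"
      proof
        assume eq: "ins y y = m"
        then have "E y m" using y(2) by auto
        then have "y \<in> range num" using m(2) y(1) by (auto simp: B_def)
        then have "m \<in> range num" using eq num.simps(2) by (metis rangeE rangeI)
        then show False using m(1) by (simp add: B_def)
      qed
      then show ?thesis using y indW W'(2) by (auto simp: has_numerals_def)
    qed
    moreover have "E (num 0) W'"
      using indW W'(2) m(1) by (auto simp: has_numerals_def B_def)
    ultimately have "has_numerals W'" by (simp add: has_numerals_def)
    then have "E m W'" using m(1) W(2) W'(1) by (auto simp: B_def)
    then show False using W'(2) by simp
  qed
qed (auto simp: has_numerals_num)

lemma definable_numeral:
  assumes "definable_term t"
  shows "definable (\<lambda>e. t e \<in> range num)"
proof (rule definable_subst1[OF _ assms])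
  have "definable (\<lambda>e. \<forall>w\<in>V. has_numerals w \<longrightarrow> E (e 0) w)"
    by (intro definable_intros definable_has_numerals)
  then show "definable (\<lambda>e. e 0 \<in> range num)"
    by (rule definable_cong) (simp add: numeral_iff_inductive env_in)
qed

lemma omega_exists: "\<exists>w\<in>V. \<forall>z. E z w \<longleftrightarrow> z \<in> range num"
proof -
  obtain I where I: "I \<in> V" "has_numerals I"
  proof -
    have "\<exists>I\<in>V. has_numerals I"
    proof (rule ccontr)
      \<comment> \<open>Without inductive sets the condition in \<open>numeral_iff_inductive\<close>
        would hold vacuously and every element of \<open>V\<close> would be a numeral; but
        \<open>{1}\<close> contains 1 and not 0.\<close>
      assume "\<not> (\<exists>I\<in>V. has_numerals I)"
      then have "z \<in> range num" if "z \<in> V" for z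
        using numeral_iff_inductive[OF that] by blast
      then obtain n where "up (num 1) (num 1) = num n" by blast
      then have "E z (up (num 1) (num 1)) \<longleftrightarrow> E z (num n)" for z by simp
      from this[of "num 1"] this[of "num 0"] show False by (auto simp: E_num)
    qed
    then show thesis using that by blast
  qed
  from separation[of "\<lambda>z _. z \<in> range num", OF definable_numeral[OF definable_term_var] I(1) I(1)]
  obtain w where "w \<in> V" "\<And>z. E z w \<longleftrightarrow> E z I \<and> z \<in> range num" by blast
  then show ?thesis using has_numerals_num[OF I(2)] by (intro bexI[of _ w]) auto
qed

text \<open>The value at \<open>n\<close> of the function defined by recursion from the base case \<open>Z\<close> and the step
  \<open>H\<close>, with parameter \<open>p\<close>. The closure condition on \<open>g\<close> stops at \<open>n\<close>, so that a finite \<open>g\<close>,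
  which always belongs to the model, witnesses the values.\<close>

definition rec_value ::
    "('u \<Rightarrow> 'u \<Rightarrow> bool) \<Rightarrow> ('u \<Rightarrow> 'u \<Rightarrow> 'u \<Rightarrow> bool) \<Rightarrow> 'u \<Rightarrow> 'u \<Rightarrow> 'u \<Rightarrow> bool" where
  "rec_value Z H p n y \<longleftrightarrow>
     (\<forall>g\<in>V. (\<forall>z\<in>V. Z p z \<longrightarrow> E (op (num 0) z) g) \<and>
        (\<forall>i\<in>V. \<forall>j\<in>V. \<forall>k\<in>V. E i n \<and> E (op i j) g \<and> H p j k \<longrightarrow> E (op (ins i i) k) g) \<longrightarrow>
        E (op n y) g)"

lemma definable_rec_value:
  assumes "definable (\<lambda>e. Z (e 0) (e 1))" "definable (\<lambda>e. H (e 0) (e 1) (e 2))"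
  shows "definable (\<lambda>e. rec_value Z H (e 0) (e 1) (e 2))"
  unfolding rec_value_def
  by (intro definable_intros term_intros definable_subst2[where R = Z, OF assms(1)] definable_subst3[where R = H, OF assms(2)])

text \<open>The graph of \<open>F\<close> up to \<open>n\<close> is finite, hence in the model, and
  closed under the clauses; so no value other than \<open>F n\<close> is forced at \<open>n\<close>.
  Conversely, induction up to \<open>n\<close> places the graph of \<open>F\<close> in every closed
  \<open>g\<close>.\<close>

lemma rec_value_iff:
  assumes "p \<in> V" "y \<in> V" and F: "\<And>n. F n \<in> V"
    and Z: "\<And>z. z \<in> V \<Longrightarrow> Z p z \<longleftrightarrow> z = F 0"
    and H: "\<And>n z. z \<in> V \<Longrightarrow> H p (F n) z \<longleftrightarrow> z = F (Suc n)"
  shows "rec_value Z H p (num n) y \<longleftrightarrow> y = F n"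
proof
  assume *: "rec_value Z H p (num n) y"
  have "finite ((\<lambda>i. op (num i) (F i)) ` {..n})" by simp
  from finite_subset_in[OF this] F obtain g
    where g: "g \<in> V" "\<And>z. E z g \<longleftrightarrow> (\<exists>i\<le>n. z = op (num i) (F i))"
    by (auto simp: image_iff Bex_def)
  have "E (op (num n) y) g"
  proof (rule *[unfolded rec_value_def, rule_format, OF g(1)], intro conjI ballI impI)
    fix z assume "z \<in> V" "Z p z"
    then show "E (op (num 0) z) g" using g(2) Z by auto
  next
    fix i j k assume V: "i \<in> V" "j \<in> V" "k \<in> V"
      and ijk: "E i (num n) \<and> E (op i j) g \<and> H p j k"
    \<comment> \<open>The guard \<open>E i n\<close> gives \<open>m < n\<close>, so the successor
      index still lies in the finite graph.\<close>
    then obtain m where m: "m < n" "i = num m" by (auto simp: E_num)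
    have "j = F m" using ijk V m F by (auto simp: g(2))
    then have "k = F (Suc m)" using ijk H V by simp
    then show "E (op (ins i i) k) g"
      using m unfolding g(2) by (intro exI[of _ "Suc m"]) (simp add: num.simps(2))
  qed
  then show "y = F n" using F \<open>y \<in> V\<close> by (auto simp: g(2))
next
  assume y: "y = F n"
  show "rec_value Z H p (num n) y"
    unfolding rec_value_def
  proof (intro ballI impI, elim conjE)
    fix g assume "g \<in> V" and base: "\<forall>z\<in>V. Z p z \<longrightarrow> E (op (num 0) z) g"
      and step: "\<forall>i\<in>V. \<forall>j\<in>V. \<forall>k\<in>V. E i (num n) \<and> E (op i j) g \<and> H p j k \<longrightarrow> E (op (ins i i) k) g"
    have "i \<le> n \<Longrightarrow> E (op (num i) (F i)) g" for i
    proof (induction i)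
      case 0
      show ?case using base[rule_format, of "F 0"] Z[of "F 0"] F by simp
    next
      case (Suc i)
      then have "E (num i) (num n) \<and> E (op (num i) (F i)) g \<and> H p (F i) (F (Suc i))"
        using H[of "F (Suc i)" i] F by simp
      with step[rule_format, of "num i" "F i" "F (Suc i)"] F show ?case
        by (simp only: num.simps(2) num_in simp_thms)
    qed
    then show "E (op (num n) y) g" using y by blast
  qed
qed

end

section \<open>Arithmetic in the model\<close>

context transitive_model
begin

text \<open>Decoding sends everything that is not a numeral to 0, so quantifiers over the natural
  numbers become quantifiers over the model.\<close>

definition nat_of :: "'u \<Rightarrow> nat" where
  "nat_of x = (if x \<in> range num then THE n. x = num n else 0)"

lemma nat_of_num [simp]: "nat_of (num n) = n"
  by (simp add: nat_of_def)

definition nat_term :: "((nat \<Rightarrow> 'u) \<Rightarrow> nat) \<Rightarrow> bool" where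
  "nat_term t \<longleftrightarrow> definable_term (\<lambda>e. num (t e))"

lemma definable_term_num_of: "nat_term t \<Longrightarrow> definable_term (\<lambda>e. num (t e))"
  by (simp add: nat_term_def)

lemma nat_term_nat_of:
  assumes "definable_term t"
  shows "nat_term (\<lambda>e. nat_of (t e))"
  unfolding nat_term_def
proof (rule definable_term1[where F = "\<lambda>x. num (nat_of x)", OF _ _ assms])
  have "definable (\<lambda>e. e 1 \<in> range num \<and> e 0 = e 1 \<or> e 1 \<notin> range num \<and> e 0 = num 0)"
    by (intro definable_intros definable_numeral term_intros)
  then show "definable (\<lambda>e. e 0 = num (nat_of (e 1)))"
    by (rule definable_cong) (auto simp: nat_of_def)
qed auto

lemma definable_nat_eq: "nat_term t \<Longrightarrow> nat_term s \<Longrightarrow> definable (\<lambda>e. t e = s e)"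
  unfolding nat_term_def using definable_eq_terms[of "\<lambda>e. num (t e)" "\<lambda>e. num (s e)"] by simp

lemma definable_nat_less: "nat_term t \<Longrightarrow> nat_term s \<Longrightarrow> definable (\<lambda>e. t e < s e)"
  unfolding nat_term_def using definable_mem_terms[of "\<lambda>e. num (t e)" "\<lambda>e. num (s e)"] by simp

lemma definable_nat_le: "nat_term t \<Longrightarrow> nat_term s \<Longrightarrow> definable (\<lambda>e. t e \<le> s e)"
  using definable_not[OF definable_nat_less, of s t] by (simp add: not_less)

lemma definable_nat_all:
  assumes "definable (\<lambda>e. P (nat_of (e 0)) (\<lambda>i. e (Suc i)))"
  shows "definable (\<lambda>e. \<forall>n. P n e)"
proof (rule definable_cong)
  show "definable (\<lambda>e. \<forall>x\<in>V. P (nat_of x) e)"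
    by (rule definable_ball) (rule assms)
qed (metis nat_of_num num_in)

lemma definable_nat_ex:
  assumes "definable (\<lambda>e. P (nat_of (e 0)) (\<lambda>i. e (Suc i)))"
  shows "definable (\<lambda>e. \<exists>n. P n e)"
  using definable_not[OF definable_nat_all[of "\<lambda>n e. \<not> P n e"]] definable_not[OF assms] by simp

lemma nat_term1:
  assumes "definable (\<lambda>e. nat_of (e 0) = f (nat_of (e 1)))" "nat_term t"
  shows "nat_term (\<lambda>e. f (t e))"
proof -
  \<comment> \<open>Requiring a numeral matters, because \<open>nat_of\<close> also sends
    nonnumerals to 0.\<close>
  have "definable (\<lambda>e. e 0 \<in> range num \<and> nat_of (e 0) = f (nat_of (e 1)))"
    by (intro definable_conj definable_numeral definable_term_var assms)
  then have "definable (\<lambda>e. e 0 = num (f (nat_of (e 1))))"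
    by (rule definable_cong) auto
  from definable_term1[where F = "\<lambda>x. num (f (nat_of x))",
      OF this _ definable_term_num_of[OF assms(2)]]
  show ?thesis by (simp add: nat_term_def)
qed

lemma nat_term2:
  assumes "definable (\<lambda>e. nat_of (e 0) = f (nat_of (e 1)) (nat_of (e 2)))" "nat_term t" "nat_term s"
  shows "nat_term (\<lambda>e. f (t e) (s e))"
proof -
  have "definable (\<lambda>e. e 0 \<in> range num \<and> nat_of (e 0) = f (nat_of (e 1)) (nat_of (e 2)))"
    by (intro definable_conj definable_numeral definable_term_var assms)
  then have "definable (\<lambda>e. e 0 = num (f (nat_of (e 1)) (nat_of (e 2))))"
    by (rule definable_cong) auto
  from definable_term2[where F = "\<lambda>x y. num (f (nat_of x) (nat_of y))",
      OF this _ assms(2,3)[THEN definable_term_num_of]]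
  show ?thesis by (simp add: nat_term_def)
qed

lemma nat_term_const: "nat_term (\<lambda>e. n)"
  by (simp add: nat_term_def definable_term_num)

lemma nat_term_Suc: "nat_term t \<Longrightarrow> nat_term (\<lambda>e. Suc (t e))"
  unfolding nat_term_def num.simps(2) by (intro definable_term_ins)

lemmas nat_var = nat_term_nat_of[OF definable_term_var]

lemma nat_term_add: "nat_term t \<Longrightarrow> nat_term s \<Longrightarrow> nat_term (\<lambda>e. t e + s e)"
proof (rule nat_term2[where f = "(+)"])
  \<comment> \<open>Addition by recursion on the second summand, with the first as
    parameter.\<close>
  define Z H where "Z p z \<longleftrightarrow> z = p" and "H p j k \<longleftrightarrow> k = ins j j" for p j k z :: 'u
  have rv: "rec_value Z H (num m) (num n) (num k) \<longleftrightarrow> k = m + n" for m n k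
    by (subst rec_value_iff[where F = "\<lambda>n. num (m + n)"]) (auto simp: Z_def H_def num.simps(2))
  have rec: "definable (\<lambda>e. rec_value Z H (e 0) (e 1) (e 2))"
    unfolding Z_def H_def by (intro definable_rec_value definable_intros term_intros)
  have "definable (\<lambda>e. rec_value Z H (num (nat_of (e 1))) (num (nat_of (e 2))) (num (nat_of (e 0))))"
    by (intro definable_subst3[where R = "rec_value Z H", OF rec] definable_term_num_of nat_var)
  then show "definable (\<lambda>e. nat_of (e 0) = nat_of (e 1) + nat_of (e 2))"
    by (simp add: rv)
qed

lemma nat_term_mult: "nat_term t \<Longrightarrow> nat_term s \<Longrightarrow> nat_term (\<lambda>e. t e * s e)"
proof (rule nat_term2[where f = "(*)"])
  \<comment> \<open>Multiplication iterates the addition of the parameter, which is already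
    available as a term on decoded numbers.\<close>
  define Z H where "Z p z \<longleftrightarrow> z = num 0" and "H p j k \<longleftrightarrow> k = num (nat_of j + nat_of p)"
    for p j k z :: 'u
  have rv: "rec_value Z H (num m) (num n) (num k) \<longleftrightarrow> k = m * n" for m n k
    by (subst rec_value_iff[where F = "\<lambda>n. num (m * n)"]) (auto simp: Z_def H_def algebra_simps)
  have rec: "definable (\<lambda>e. rec_value Z H (e 0) (e 1) (e 2))"
    unfolding Z_def H_def
    by (intro definable_rec_value definable_intros term_intros definable_term_num_of
        nat_term_add nat_var)
  have "definable (\<lambda>e. rec_value Z H (num (nat_of (e 1))) (num (nat_of (e 2))) (num (nat_of (e 0))))"
    by (intro definable_subst3[where R = "rec_value Z H", OF rec] definable_term_num_of nat_var)
  then show "definable (\<lambda>e. nat_of (e 0) = nat_of (e 1) * nat_of (e 2))"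
    by (simp add: rv)
qed

lemmas nat_basics =
  nat_var nat_term_const nat_term_Suc nat_term_add nat_term_mult
  definable_not definable_conj definable_disj definable_imp definable_iff
  definable_nat_eq definable_nat_less definable_nat_le definable_nat_all definable_nat_ex

lemma nat_term_diff: "nat_term t \<Longrightarrow> nat_term s \<Longrightarrow> nat_term (\<lambda>e. t e - s e)"
proof (rule nat_term2[where f = "(-)"])
  \<comment> \<open>The second disjunct accounts for truncation at 0.\<close>
  have "definable (\<lambda>e. nat_of (e 0) + nat_of (e 2) = nat_of (e 1)
      \<or> nat_of (e 0) = 0 \<and> nat_of (e 1) \<le> nat_of (e 2))"
    by (intro nat_basics)
  then show "definable (\<lambda>e. nat_of (e 0) = nat_of (e 1) - nat_of (e 2))"
    by (rule definable_cong) auto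
qed

lemma nat_term_half: "nat_term t \<Longrightarrow> nat_term (\<lambda>e. t e div 2)"
proof (rule nat_term1[where f = "\<lambda>n. n div 2"])
  have "definable (\<lambda>e. nat_of (e 0) + nat_of (e 0) = nat_of (e 1)
      \<or> Suc (nat_of (e 0) + nat_of (e 0)) = nat_of (e 1))"
    by (intro nat_basics)
  then show "definable (\<lambda>e. nat_of (e 0) = nat_of (e 1) div 2)"
    by (rule definable_cong) presburger
qed

lemma definable_even:
  assumes "nat_term t"
  shows "definable (\<lambda>e. even (t e))"
proof -
  have "definable (\<lambda>e. 2 * (t e div 2) = t e)"
    using assms by (intro nat_basics nat_term_half)
  then show ?thesis by (rule definable_cong) (metis dvd_mult_div_cancel dvd_triv_left)
qed

lemma nat_term_if:
  assumes P: "definable P" and t: "nat_term t" and s: "nat_term s"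
  shows "nat_term (\<lambda>e. if P e then t e else s e)"
proof -
  have "definable (\<lambda>e. P (\<lambda>i. e (Suc i)))"
    using definable_rename[OF P, of Suc] by simp
  then have "definable (\<lambda>e. P (\<lambda>i. e (Suc i)) \<and> e 0 = num (t (\<lambda>i. e (Suc i)))
      \<or> \<not> P (\<lambda>i. e (Suc i)) \<and> e 0 = num (s (\<lambda>i. e (Suc i))))"
    using t s unfolding nat_term_def definable_term_def
    by (intro definable_conj definable_disj definable_not) auto
  then have "definable (\<lambda>e. e 0 = num (if P (\<lambda>i. e (Suc i)) then t (\<lambda>i. e (Suc i)) else s (\<lambda>i. e (Suc i))))"
    by (rule definable_cong) simp
  then show ?thesis by (simp add: nat_term_def definable_term_def)
qed

lemma nat_term_prod_encode:
  assumes "nat_term t" "nat_term s"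
  shows "nat_term (\<lambda>e. prod_encode (t e, s e))"
proof -
  \<comment> \<open>Cantor pairing: a triangular number, written with \<open>div 2\<close>, plus the
    first component.\<close>
  have "nat_term (\<lambda>e. ((t e + s e) * Suc (t e + s e)) div 2 + t e)"
    using assms by (intro nat_basics nat_term_half)
  then show ?thesis by (simp add: prod_encode_def triangle_def)
qed

text \<open>The first component is the unique number that some second component completes to the
  given code, so decoding takes only the encoding and a quantifier.\<close>

lemma nat_term_fst_prod_decode:
  "nat_term t \<Longrightarrow> nat_term (\<lambda>e. fst (prod_decode (t e)))"
proof (rule nat_term1[where f = "\<lambda>n. fst (prod_decode n)"])
  have "definable (\<lambda>e. \<exists>y. prod_encode (nat_of (e 0), y) = nat_of (e 1))"
    by (intro nat_basics nat_term_prod_encode)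
  then show "definable (\<lambda>e. nat_of (e 0) = fst (prod_decode (nat_of (e 1))))"
    by (rule definable_cong) (metis fst_conv prod.collapse prod_decode_inverse prod_encode_inverse)
qed

lemma nat_term_snd_prod_decode:
  "nat_term t \<Longrightarrow> nat_term (\<lambda>e. snd (prod_decode (t e)))"
proof (rule nat_term1[where f = "\<lambda>n. snd (prod_decode n)"])
  have "definable (\<lambda>e. \<exists>y. prod_encode (y, nat_of (e 0)) = nat_of (e 1))"
    by (intro nat_basics nat_term_prod_encode)
  then show "definable (\<lambda>e. nat_of (e 0) = snd (prod_decode (nat_of (e 1))))"
    by (rule definable_cong) (metis snd_conv prod.collapse prod_decode_inverse prod_encode_inverse)
qed

lemmas nat_intros = nat_basics nat_term_diff nat_term_half definable_even nat_term_if
  nat_term_prod_encode nat_term_fst_prod_decode nat_term_snd_prod_decode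

end

section \<open>Arithmetic of rational indices\<close>

text \<open>\<open>int_decode\<close> sends even numbers to their halves and odd ones to negative
  integers. Splitting integers into differences of natural numbers keeps all arithmetic within
  \<open>nat_term\<close>.\<close>

definition positive_part :: "nat \<Rightarrow> nat" where
  "positive_part x = (if even x then x div 2 else 0)"

definition negative_part :: "nat \<Rightarrow> nat" where
  "negative_part x = (if even x then 0 else Suc (x div 2))"

lemma int_decode_parts: "int_decode x = int (positive_part x) - int (negative_part x)"
  by (simp add: int_decode_def sum_decode_def positive_part_def negative_part_def)

text \<open>Indexed rationals are rewritten with a positive denominator. Code 0 stands for division
  by zero, whose value is 0, and becomes \<open>0 / 1\<close>; an odd code is a negative
  denominator, whose sign moves to the numerator by exchanging its two parts.\<close>

definition denominator :: "nat \<Rightarrow> nat" where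
  "denominator n = (let v = snd (prod_decode n) in
     if v = 0 then 1 else positive_part v + negative_part v)"

definition numerator_pos :: "nat \<Rightarrow> nat" where
  "numerator_pos n = (let u = fst (prod_decode n); v = snd (prod_decode n) in
     if v = 0 then 0 else if even v then positive_part u else negative_part u)"

definition numerator_neg :: "nat \<Rightarrow> nat" where
  "numerator_neg n = (let u = fst (prod_decode n); v = snd (prod_decode n) in
     if v = 0 then 0 else if even v then negative_part u else positive_part u)"

lemma denominator_pos [simp]: "denominator n > 0"
  by (auto simp: denominator_def positive_part_def negative_part_def Let_def elim!: evenE)

lemma ratr_prod_encode:
  "ratr (prod_encode (u, v)) = of_int (int_decode u) / of_int (int_decode v)"
  by (simp add: ratr_def nat_to_rat_surj_def Fract_of_int_quotient of_rat_divide)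

lemma ratr_eq: "ratr n = (real (numerator_pos n) - real (numerator_neg n)) / real (denominator n)"
proof -
  obtain u v where n: "n = prod_encode (u, v)" by (metis prod.collapse prod_decode_inverse)
  define P M where "P = real (positive_part u)" and "M = real (negative_part u)"
  have u: "of_int (int_decode u) = P - M" by (simp add: int_decode_parts P_def M_def)
  consider "v = 0" | "v \<noteq> 0" "even v" | "odd v" by auto
  then show ?thesis
  proof cases
    case 3
    have "(P - M) / (- 1 - d) = (M - P) / (1 + d)" if "d \<ge> 0" for d :: real
      using that by (simp add: divide_simps) (simp add: algebra_simps)
    from this[of "real (v div 2)"] 3 show ?thesis
      by (auto simp: n ratr_prod_encode u int_decode_parts[of v] denominator_def numerator_pos_def
          numerator_neg_def positive_part_def[of v] negative_part_def[of v] P_def M_def)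
  qed (auto simp: n ratr_prod_encode u int_decode_parts[of v] denominator_def numerator_pos_def
      numerator_neg_def positive_part_def[of v] negative_part_def[of v] P_def M_def
      int_decode_def[of 0] sum_decode_def)
qed

text \<open>Cross-multiplying by positive denominators and moving the negative parts to the other
  side leaves a comparison of natural numbers, which is definable.\<close>

lemma ratr_less_iff:
  "ratr m < ratr n \<longleftrightarrow>
     numerator_pos m * denominator n + numerator_neg n * denominator m
     < numerator_pos n * denominator m + numerator_neg m * denominator n"
proof -
  have "ratr m < ratr n \<longleftrightarrow>
      (real (numerator_pos m) - real (numerator_neg m)) * real (denominator n)
      < (real (numerator_pos n) - real (numerator_neg n)) * real (denominator m)"
    by (simp add: ratr_eq divide_less_eq less_divide_eq field_simps)
  also have "\<dots> \<longleftrightarrow> real (numerator_pos m * denominator n + numerator_neg n * denominator m)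
     < real (numerator_pos n * denominator m + numerator_neg m * denominator n)"
    by (simp add: algebra_simps)
  finally show ?thesis by (simp only: of_nat_less_iff)
qed

text \<open>The two branches encode the integer \<open>p - q\<close>, a nonnegative one as an even
  and a negative one as an odd number; the even number \<open>2 * d\<close> encodes the
  denominator.\<close>

definition index_of_quotient :: "nat \<Rightarrow> nat \<Rightarrow> nat \<Rightarrow> nat" where
  "index_of_quotient p q d =
     prod_encode (if q \<le> p then 2 * (p - q) else 2 * (q - p) - 1, 2 * d)"

lemma ratr_index_of_quotient: "ratr (index_of_quotient p q d) = (real p - real q) / real d"
proof -
  have "odd (2 * (q - p) - 1)" "(2 * (q - p) - 1) div 2 = q - p - 1" if "\<not> q \<le> p"
    using that by presburger+
  then show ?thesis
    by (auto simp: index_of_quotient_def ratr_prod_encode int_decode_parts positive_part_def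
        negative_part_def of_nat_diff)
qed

text \<open>The reciprocal is the half-length of the \<open>n\<close>-th interval; the product of
  consecutive numbers makes the lengths telescope.\<close>

definition interval_scale :: "nat \<Rightarrow> nat \<Rightarrow> nat" where
  "interval_scale K n = K * (Suc n * Suc (Suc n))"

definition left_end :: "nat \<Rightarrow> nat \<Rightarrow> nat" where
  "left_end K n = index_of_quotient (numerator_pos n * interval_scale K n)
     (numerator_neg n * interval_scale K n + denominator n) (denominator n * interval_scale K n)"

definition right_end :: "nat \<Rightarrow> nat \<Rightarrow> nat" where
  "right_end K n = index_of_quotient (numerator_pos n * interval_scale K n + denominator n)
     (numerator_neg n * interval_scale K n) (denominator n * interval_scale K n)"

lemma interval_scale_pos: "K > 0 \<Longrightarrow> interval_scale K n > 0"
  by (simp add: interval_scale_def)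

lemma ratr_left_end:
  assumes "K > 0"
  shows "ratr (left_end K n) = ratr n - 1 / real (interval_scale K n)"
proof -
  have "(p * l - (q * l + d)) / (d * l) = (p - q) / d - 1 / l" if "d > 0" "l > 0" for p q d l :: real
    using that by (simp add: field_simps)
  from this[of "real (denominator n)" "real (interval_scale K n)"] show ?thesis
    using interval_scale_pos[OF assms, of n]
    by (simp add: left_end_def ratr_index_of_quotient ratr_eq[of n])
qed

lemma ratr_right_end:
  assumes "K > 0"
  shows "ratr (right_end K n) = ratr n + 1 / real (interval_scale K n)"
proof -
  have "(p * l + d - q * l) / (d * l) = (p - q) / d + 1 / l" if "d > 0" "l > 0" for p q d l :: real
    using that by (simp add: field_simps)
  from this[of "real (denominator n)" "real (interval_scale K n)"] show ?thesis
    using interval_scale_pos[OF assms, of n]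
    by (simp add: right_end_def ratr_index_of_quotient ratr_eq[of n])
qed

lemma sum_interval_lengths:
  assumes "K > 0"
  shows "(\<Sum>n<N. ratr (right_end K n) - ratr (left_end K n)) = 2 / real K * (1 - 1 / real (Suc N))"
proof (induction N)
  case (Suc N)
  \<comment> \<open>The partial fraction identity behind the telescoping, used at
    \<open>x = real (Suc N)\<close>.\<close>
  have "2 / (k * (x * (x + 1))) = 2 / k * (1 / x - 1 / (x + 1))" if "k > 0" "x > 0" for k x :: real
    using that by (simp add: field_simps)
  note this[of "real K" "real (Suc N)"]
  moreover have "real (interval_scale K N) = real K * (real (Suc N) * (real (Suc N) + 1))"
    by (simp add: interval_scale_def algebra_simps)
  ultimately have "2 / real (interval_scale K N)
      = 2 / real K * (1 / real (Suc N) - 1 / real (Suc (Suc N)))"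
    using assms by (simp add: add.commute)
  then have "ratr (right_end K N) - ratr (left_end K N)
      = 2 / real K * (1 / real (Suc N) - 1 / real (Suc (Suc N)))"
    using assms by (simp only: ratr_left_end ratr_right_end)
  then show ?case using Suc by (simp add: algebra_simps del: of_nat_Suc)
qed simp

text \<open>Entry 0 marks a complement and entry 1 a union. From entry 2 on, \<open>k - 2\<close>
  decodes to an interval number and a position in the code of that interval: position 0 holds its
  tag, positions 1 and 2 its endpoints.\<close>

definition complement_code :: "nat \<Rightarrow> nat \<Rightarrow> nat" where
  "complement_code K k =
     (if k = 0 then 1 else if k = 1 then 2
      else if snd (prod_decode (k - 2)) = 0 then 0
      else if snd (prod_decode (k - 2)) = 1 then left_end K (fst (prod_decode (k - 2)))
      else right_end K (fst (prod_decode (k - 2))))"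

lemma borel_code_complement_code:
  "borel_code (complement_code K)
     (- (\<Union>n. {ratr (left_end K n)<..<ratr (right_end K n)}))"
proof (rule borel_code.complement)
  show "borel_code (\<lambda>m. complement_code K (Suc m))
      (\<Union>n. {ratr (left_end K n)<..<ratr (right_end K n)})"
  proof (rule borel_code.union)
    fix n
    define c where "c m = complement_code K (Suc (Suc (prod_encode (n, m))))" for m
    have c: "c 0 = 0" "c 1 = left_end K n" "c 2 = right_end K n"
      by (simp_all add: c_def complement_code_def)
    show "borel_code (\<lambda>m. complement_code K (Suc (Suc (prod_encode (n, m)))))
        {ratr (left_end K n)<..<ratr (right_end K n)}"
      using borel_code.interval[of c] c unfolding c_def by simp
  qed (simp add: complement_code_def)
qed (simp add: complement_code_def)

lemma ratr_surj_Rats: "range ratr = \<rat>"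
proof -
  have "ratr = of_rat \<circ> nat_to_rat_surj" by (simp add: fun_eq_iff ratr_def)
  then show ?thesis by (simp only: Rats_eq_range_of_rat_o_nat_to_rat_surj)
qed

lemma rational_between:
  assumes "x < (y::real)"
  obtains n where "x < ratr n" "ratr n < y"
  using Rats_dense_in_real[OF assms] ratr_surj_Rats by (metis imageE)

section \<open>Definability of endpoints and codes\<close>

context transitive_model
begin

lemma nat_term_positive_part: "nat_term t \<Longrightarrow> nat_term (\<lambda>e. positive_part (t e))"
  unfolding positive_part_def by (intro nat_intros)

lemma nat_term_negative_part: "nat_term t \<Longrightarrow> nat_term (\<lambda>e. negative_part (t e))"
  unfolding negative_part_def by (intro nat_intros)

lemma nat_term_denominator: "nat_term t \<Longrightarrow> nat_term (\<lambda>e. denominator (t e))"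
  unfolding denominator_def Let_def
  by (intro nat_intros nat_term_positive_part nat_term_negative_part)

lemma nat_term_numerator_pos: "nat_term t \<Longrightarrow> nat_term (\<lambda>e. numerator_pos (t e))"
  unfolding numerator_pos_def Let_def
  by (intro nat_intros nat_term_positive_part nat_term_negative_part)

lemma nat_term_numerator_neg: "nat_term t \<Longrightarrow> nat_term (\<lambda>e. numerator_neg (t e))"
  unfolding numerator_neg_def Let_def
  by (intro nat_intros nat_term_positive_part nat_term_negative_part)

lemmas nat_term_fraction = nat_term_denominator nat_term_numerator_pos nat_term_numerator_neg

lemma definable_ratr_less: "nat_term t \<Longrightarrow> nat_term s \<Longrightarrow> definable (\<lambda>e. ratr (t e) < ratr (s e))"
  unfolding ratr_less_iff by (intro nat_intros nat_term_fraction)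

lemma nat_term_left_end: "nat_term t \<Longrightarrow> nat_term (\<lambda>e. left_end K (t e))"
  unfolding left_end_def index_of_quotient_def interval_scale_def
  by (intro nat_intros nat_term_fraction)

lemma nat_term_right_end: "nat_term t \<Longrightarrow> nat_term (\<lambda>e. right_end K (t e))"
  unfolding right_end_def index_of_quotient_def interval_scale_def
  by (intro nat_intros nat_term_fraction)

lemma nat_term_complement_code: "nat_term t \<Longrightarrow> nat_term (\<lambda>e. complement_code K (t e))"
  unfolding complement_code_def
  by (intro nat_intros nat_term_left_end nat_term_right_end)

end

section \<open>Names for arithmetical functions\<close>

context transitive_model
begin

text \<open>Preserving \<open>nat_term\<close> expresses that \<open>f\<close> is arithmetical;
  Replacement on omega then yields its graph.\<close>

lemma function_in_model:
  assumes f: "\<And>t. nat_term t \<Longrightarrow> nat_term (\<lambda>e. f (t e))"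
  shows "function_in E V f"
proof -
  obtain w where w: "w \<in> V" "\<And>z. E z w \<longleftrightarrow> z \<in> range num" using omega_exists by blast
  define F where "F x = op (num (nat_of x)) (num (f (nat_of x)))" for x
  have "definable_term (\<lambda>e. F (e 0))"
    unfolding F_def by (intro term_intros definable_term_num_of f nat_var)
  from replacement[OF this w(1)] obtain b
    where b: "b \<in> V" "\<And>z. E z b \<longleftrightarrow> (\<exists>x. E x w \<and> z = F x)" by blast
  have "E z b \<longleftrightarrow> (\<exists>n. is_numeral_pair E n (f n) z)" for z
    by (auto simp: b(2) w(2) is_numeral_pair_iff F_def)
  with b(1) show ?thesis unfolding function_in_def by blast
qed

text \<open>The canonical name of the numeral \<open>n\<close>, built like the von Neumann
  successor. The component \<open>num 0\<close> is the empty condition, the weakest one.\<close>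

primrec check :: "nat \<Rightarrow> 'u" where
  "check 0 = num 0"
| "check (Suc n) = ins (op (check n) (num 0)) (check n)"

lemma check_in [simp]: "check n \<in> V"
  by (induction n) auto

text \<open>\<open>check\<close> is defined by recursion outside the model, so its graph is
  recovered through \<open>rec_value\<close>; Replacement can then collect names built from
  it.\<close>

lemma definable_term_check:
  assumes "nat_term t"
  shows "definable_term (\<lambda>e. check (t e))"
proof -
  define Z H where "Z p z \<longleftrightarrow> z = num 0" and "H p j k \<longleftrightarrow> k = ins (op j (num 0)) j"
    for p j k z :: 'u
  have rv: "rec_value Z H (num 0) (num n) y \<longleftrightarrow> y = check n" if "y \<in> V" for n y
    using that by (subst rec_value_iff[where F = check]) (auto simp: Z_def H_def)
  have rec: "definable (\<lambda>e. rec_value Z H (e 0) (e 1) (e 2))"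
    unfolding Z_def H_def by (intro definable_rec_value definable_intros term_intros)
  have "definable (\<lambda>e. rec_value Z H (num 0) (num (nat_of (e 1))) (e 0))"
    by (intro definable_subst3[where R = "rec_value Z H", OF rec] definable_term_num_of nat_var
        nat_term_const term_intros)
  then have "definable (\<lambda>e. e 0 = check (nat_of (e 1)))"
    by (rule definable_cong) (simp add: rv env_in)
  from definable_term1[where F = "\<lambda>x. check (nat_of x)", OF this _ definable_term_num_of[OF assms]]
  show ?thesis by simp
qed

text \<open>All pairs in such a name carry the trivial condition, so the filter discards none of
  them and the value is the set of values of all names in \<open>S\<close>.\<close>

definition plain_name :: "'u \<Rightarrow> 'u set \<Rightarrow> bool" where
  "plain_name \<tau> S \<longleftrightarrow> \<tau> \<in> V \<and> S \<subseteq> names_of E V \<and> (\<forall>z. E z \<tau> \<longleftrightarrow> (\<exists>\<sigma>\<in>S. z = op \<sigma> (num 0)))"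

lemma cohen_condition_num_0: "cohen_condition E (num 0)"
  unfolding cohen_condition_def by (intro exI[of _ 0]) (simp add: not_E_num_0)

lemma plain_name_names_of:
  assumes "plain_name \<tau> S"
  shows "\<tau> \<in> names_of E V"
proof -
  have "cohen_name E \<tau>"
  proof (rule cohen_name.intros)
    fix z assume "E z \<tau>"
    then obtain \<sigma> where "\<sigma> \<in> names_of E V" "z = op \<sigma> (num 0)"
      using assms unfolding plain_name_def by blast
    then show "\<exists>\<sigma> p. is_opair E \<sigma> p z \<and> cohen_condition E p \<and> cohen_name E \<sigma>"
      using cohen_condition_num_0
      by (intro exI[of _ \<sigma>] exI[of _ "num 0"]) (auto simp: names_of_def is_opair_iff)
  qed
  then show ?thesis using assms by (simp add: names_of_def plain_name_def)
qed

lemma plain_name_check: "plain_name (check n) (check ` {..<n})"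
proof (induction n)
  case 0
  show ?case by (simp add: plain_name_def not_E_num_0)
next
  case (Suc n)
  then show ?case using plain_name_names_of[OF Suc]
    by (auto simp: plain_name_def lessThan_Suc)
qed

text \<open>Names for unordered and, below, ordered pairs of the values, mirroring \<open>up\<close>
  and \<open>op\<close>.\<close>

definition name_up :: "'u \<Rightarrow> 'u \<Rightarrow> 'u" where
  "name_up \<sigma> \<tau> = up (op \<sigma> (num 0)) (op \<tau> (num 0))"

definition name_op :: "'u \<Rightarrow> 'u \<Rightarrow> 'u" where
  "name_op \<sigma> \<tau> = name_up (name_up \<sigma> \<sigma>) (name_up \<sigma> \<tau>)"

lemma plain_name_up:
  "\<sigma> \<in> names_of E V \<Longrightarrow> \<tau> \<in> names_of E V \<Longrightarrow> plain_name (name_up \<sigma> \<tau>) {\<sigma>, \<tau>}"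
  unfolding plain_name_def name_up_def by (auto simp: names_of_def)

end

section \<open>Values of plain names in the extension\<close>

locale cohen_extension = transitive_model +
  fixes G :: "'a set" and VG :: "'a set" and val :: "'a \<Rightarrow> 'a"
  assumes generic: "generic_filter E V G"
    and val: "\<forall>\<tau>\<in>names_of E V. \<forall>y. E y (val \<tau>) \<longleftrightarrow>
                (\<exists>\<sigma> p z. E z \<tau> \<and> is_opair E \<sigma> p z \<and> p \<in> G \<and> y = val \<sigma>)"
    and VG: "VG = val ` names_of E V"
begin

text \<open>A filter is nonempty and closed under weaker conditions, and the empty condition is
  weaker than every other.\<close>

lemma num_0_in_filter: "num 0 \<in> G"
proof -
  obtain p where "p \<in> G" using generic unfolding generic_filter_def by blast
  moreover have "num 0 \<in> cohen_forcing E V"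
    by (simp add: cohen_forcing_def cohen_condition_num_0)
  moreover have "stronger E p (num 0)" by (simp add: stronger_def not_E_num_0)
  ultimately show ?thesis using generic unfolding generic_filter_def by blast
qed

lemma val_plain_name:
  assumes "plain_name \<tau> S"
  shows "E y (val \<tau>) \<longleftrightarrow> (\<exists>\<sigma>\<in>S. y = val \<sigma>)"
proof -
  have "E y (val \<tau>) \<longleftrightarrow> (\<exists>\<sigma> p z. E z \<tau> \<and> is_opair E \<sigma> p z \<and> p \<in> G \<and> y = val \<sigma>)"
    using val plain_name_names_of[OF assms] by blast
  also have "\<dots> \<longleftrightarrow> (\<exists>\<sigma>\<in>S. y = val \<sigma>)"
  proof
    assume "\<exists>\<sigma> p z. E z \<tau> \<and> is_opair E \<sigma> p z \<and> p \<in> G \<and> y = val \<sigma>"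
    then obtain \<sigma> p z where *: "E z \<tau>" "is_opair E \<sigma> p z" "y = val \<sigma>" by blast
    then obtain \<sigma>' where \<sigma>': "\<sigma>' \<in> S" "z = op \<sigma>' (num 0)" "\<sigma>' \<in> V"
      using assms unfolding plain_name_def names_of_def by blast
    then have "z \<in> V" by simp
    with * \<sigma>' have "op \<sigma> p = op \<sigma>' (num 0)" "\<sigma> \<in> V" "p \<in> V"
      using is_opair_in[OF *(2)] by (auto simp: is_opair_iff)
    then have "\<sigma> = \<sigma>'" using \<sigma>'(3) by simp
    then show "\<exists>\<sigma>\<in>S. y = val \<sigma>" using *(3) \<sigma>'(1) by blast
  next
    assume "\<exists>\<sigma>\<in>S. y = val \<sigma>"
    then obtain \<sigma> where "\<sigma> \<in> S" "y = val \<sigma>" by blast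
    moreover from this have "E (op \<sigma> (num 0)) \<tau>" "\<sigma> \<in> V"
      using assms unfolding plain_name_def names_of_def by blast+
    moreover from this have "is_opair E \<sigma> (num 0) (op \<sigma> (num 0))" by (simp add: is_opair_iff)
    ultimately show "\<exists>\<sigma> p z. E z \<tau> \<and> is_opair E \<sigma> p z \<and> p \<in> G \<and> y = val \<sigma>"
      using num_0_in_filter by blast
  qed
  finally show ?thesis .
qed

lemma val_check: "val (check n) = num n"
proof (induction n rule: less_induct)
  case (less n)
  show ?case
    by (rule ext) (use less in \<open>auto simp: val_plain_name[OF plain_name_check] E_num\<close>)
qed

text \<open>Values may lie outside \<open>V\<close>, where \<open>op\<close> is not under control;
  hence the relational form.\<close>

lemma val_name_op:
  assumes "\<sigma> \<in> names_of E V" "\<tau> \<in> names_of E V"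
  shows "is_opair E (val \<sigma>) (val \<tau>) (val (name_op \<sigma> \<tau>))"
proof -
  note up = plain_name_up[THEN plain_name_names_of]
  have *: "is_upair E (val \<sigma>) (val \<tau>) (val (name_up \<sigma> \<tau>))"
    if "\<sigma> \<in> names_of E V" "\<tau> \<in> names_of E V" for \<sigma> \<tau>
    unfolding is_upair_def by (simp add: val_plain_name[OF plain_name_up[OF that]])
  show ?thesis
    unfolding is_opair_def name_op_def using * up assms by blast
qed

text \<open>Replacement in \<open>V\<close> gathers the names of the pairs \<open>(n, f n)\<close>
  into one plain name, whose value is the graph.\<close>

lemma function_in_extension:
  assumes f: "\<And>t. nat_term t \<Longrightarrow> nat_term (\<lambda>e. f (t e))"
  shows "function_in E VG f"
proof -
  obtain w where w: "w \<in> V" "\<And>z. E z w \<longleftrightarrow> z \<in> range num" using omega_exists by blast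
  define N where "N n = name_op (check n) (check (f n))" for n
  have check: "check n \<in> names_of E V" for n
    using plain_name_check by (rule plain_name_names_of)
  have N: "N n \<in> names_of E V" for n
    unfolding N_def name_op_def by (intro plain_name_names_of[OF plain_name_up] check)
  have "definable_term (\<lambda>e. op (N (nat_of (e 0))) (num 0))"
    unfolding N_def name_op_def name_up_def
    by (intro term_intros definable_term_check f nat_var)
  from replacement[where F = "\<lambda>x. op (N (nat_of x)) (num 0)", OF this w(1)]
  obtain b where b: "b \<in> V" "\<And>z. E z b \<longleftrightarrow> (\<exists>x. E x w \<and> z = op (N (nat_of x)) (num 0))"
    by blast
  have "plain_name b (range N)"
    using b N by (auto simp: plain_name_def w(2))
  moreover have "val (N n) = op (num n) (num (f n))" for n
    using val_name_op[OF check check, of n "f n"] by (simp add: val_check is_opair_iff N_def)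
  ultimately have "E y (val b) \<longleftrightarrow> (\<exists>n. is_numeral_pair E n (f n) y)" for y
    by (auto simp: val_plain_name is_numeral_pair_iff)
  moreover have "val b \<in> VG"
    using plain_name_names_of[OF \<open>plain_name b (range N)\<close>] VG by blast
  ultimately show ?thesis unfolding function_in_def by blast
qed

end

section \<open>Cohen reals\<close>

definition cover :: "nat \<Rightarrow> real set" where
  "cover K = (\<Union>n. {ratr (left_end K n)<..<ratr (right_end K n)})"

lemma ratr_in_cover: "K > 0 \<Longrightarrow> ratr n \<in> cover K"
  using interval_scale_pos[of K n]
  by (auto simp: cover_def ratr_left_end ratr_right_end intro!: exI[of _ n])

text \<open>The complement of the cover is closed and contains no rational, whereas every ball
  contains one.\<close>

lemma complement_cover_nowhere_dense:
  assumes "K > 0" "X \<subseteq> - cover K"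
  shows "interior (closure X) = {}"
proof -
  have "closed (- cover K)" by (auto simp: cover_def closed_def)
  with assms(2) have sub: "closure X \<subseteq> - cover K" by (rule closure_minimal)
  show ?thesis
  proof (rule ccontr)
    assume "interior (closure X) \<noteq> {}"
    then obtain x e where "e > 0" "ball x e \<subseteq> closure X"
      by (metis ex_in_conv mem_interior)
    moreover obtain n where "x < ratr n" "ratr n < x + e"
      using rational_between[of x "x + e"] \<open>e > 0\<close> by auto
    then have "ratr n \<in> ball x e" by (auto simp: dist_real_def)
    ultimately show False using sub ratr_in_cover[OF assms(1)] by blast
  qed
qed

text \<open>The supremum is the required real: \<open>ratr b\<close> is a bound because anything
  above it in the cut would put \<open>b\<close> into \<open>D\<close>, and the lack of a maximum
  gives the strict inequality.\<close>

lemma dedekind_cut_real: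
  assumes "a \<in> D" "b \<notin> D"
    and down: "\<And>m n. n \<in> D \<Longrightarrow> ratr m < ratr n \<Longrightarrow> m \<in> D"
    and no_max: "\<And>n. n \<in> D \<Longrightarrow> \<exists>m\<in>D. ratr n < ratr m"
  shows "\<exists>r. \<forall>n. n \<in> D \<longleftrightarrow> ratr n < r"
proof (intro exI allI)
  have bdd: "bdd_above (ratr ` D)"
    using down assms(2) by (intro bdd_aboveI[of _ "ratr b"]) (metis imageE not_less)
  show "n \<in> D \<longleftrightarrow> ratr n < Sup (ratr ` D)" for n
  proof
    assume "n \<in> D"
    then obtain m where "m \<in> D" "ratr n < ratr m" using no_max by blast
    moreover from this have "ratr m \<le> Sup (ratr ` D)" using bdd by (intro cSup_upper) auto
    ultimately show "ratr n < Sup (ratr ` D)" by simp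
  next
    assume "ratr n < Sup (ratr ` D)"
    then obtain m where "m \<in> D" "ratr n < ratr m"
      using less_cSup_iff[OF _ bdd] assms(1) by blast
    then show "n \<in> D" using down by blast
  qed
qed

section \<open>Meagerness of the complement in the ground model\<close>

context transitive_model
begin

lemma is_real_iff: "is_real E r x \<longleftrightarrow> (\<forall>z. E z x \<longleftrightarrow> (\<exists>n. ratr n < r \<and> z = num n))"
  by (simp add: is_real_def is_numeral_iff)

lemma is_real_in:
  assumes "is_real E r x" "r \<in> reals_of E V"
  shows "x \<in> V"
proof -
  obtain y where "y \<in> V" "is_real E r y" using assms(2) by (auto simp: reals_of_def)
  moreover from this have "x = y" using assms(1) by (intro ext) (simp add: is_real_def)
  ultimately show ?thesis by simp
qed

text \<open>The first four clauses describe a Dedekind cut. The last keeps the real out of the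
  \<open>k\<close>-th interval by means of rationals alone: once the left end is below the real, so
  is everything left of the right end. Only number quantifiers occur, so Separation applies.\<close>

definition cut_off_cover :: "nat \<Rightarrow> 'u \<Rightarrow> bool" where
  "cut_off_cover K x \<longleftrightarrow>
     (\<exists>n. E (num n) x) \<and> (\<exists>n. \<not> E (num n) x) \<and>
     (\<forall>n m. E (num n) x \<and> ratr m < ratr n \<longrightarrow> E (num m) x) \<and>
     (\<forall>n. E (num n) x \<longrightarrow> (\<exists>m. E (num m) x \<and> ratr n < ratr m)) \<and>
     (\<forall>k l. E (num (left_end K k)) x \<and> ratr l < ratr (right_end K k) \<longrightarrow> E (num l) x)"

lemma cut_off_cover_iff:
  assumes x: "x \<in> V" and sub: "\<And>z. E z x \<Longrightarrow> z \<in> range num"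
  shows "cut_off_cover K x \<longleftrightarrow> (\<exists>r\<in>- cover K. is_real E r x)"
proof
  assume cut: "cut_off_cover K x"
  note cut = cut[unfolded cut_off_cover_def]
  let ?D = "{n. E (num n) x}"
  obtain a b where ab: "a \<in> ?D" "b \<notin> ?D"
    using cut[THEN conjunct1] cut[THEN conjunct2, THEN conjunct1] by blast
  have down: "m \<in> ?D" if "n \<in> ?D" "ratr m < ratr n" for m n
    using cut[THEN conjunct2, THEN conjunct2, THEN conjunct1] that by blast
  have no_max: "\<exists>m\<in>?D. ratr n < ratr m" if "n \<in> ?D" for n
    using cut[THEN conjunct2, THEN conjunct2, THEN conjunct2, THEN conjunct1] that by blast
  have off: "E (num l) x" if "E (num (left_end K k)) x" "ratr l < ratr (right_end K k)" for k l
    using cut[THEN conjunct2, THEN conjunct2, THEN conjunct2, THEN conjunct2] that by blast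
  obtain r where r: "\<And>n. n \<in> ?D \<longleftrightarrow> ratr n < r"
  proof -
    have "\<exists>r. \<forall>n. n \<in> ?D \<longleftrightarrow> ratr n < r"
      by (rule dedekind_cut_real[OF ab]) (erule (1) down | erule no_max)+
    then show thesis using that by blast
  qed
  have "E z x \<longleftrightarrow> (\<exists>n. ratr n < r \<and> z = num n)" for z
    using sub[of z] r by blast
  then have "is_real E r x" by (simp add: is_real_iff)
  moreover have "r \<notin> cover K"
  proof
    assume "r \<in> cover K"
    then obtain k where k: "ratr (left_end K k) < r" "r < ratr (right_end K k)"
      by (auto simp: cover_def)
    \<comment> \<open>A rational strictly between the real and the right end is forced into the cut
      by the last clause.\<close>
    obtain l where l: "r < ratr l" "ratr l < ratr (right_end K k)"
      using rational_between[OF k(2)] .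
    have "E (num l) x" using off[of k l] k(1) l(2) r by simp
    then show False using r l(1) by auto
  qed
  ultimately show "\<exists>r\<in>- cover K. is_real E r x" by blast
next
  assume "\<exists>r\<in>- cover K. is_real E r x"
  then obtain r where r: "r \<notin> cover K" "is_real E r x" by blast
  have E: "E (num n) x \<longleftrightarrow> ratr n < r" for n using r(2) by (auto simp: is_real_iff)
  show "cut_off_cover K x"
    unfolding cut_off_cover_def E
  proof (intro conjI allI impI)
    show "\<exists>n. ratr n < r" using rational_between[of "r - 1" r] by auto
    show "\<exists>n. \<not> ratr n < r" using rational_between[of r "r + 1"] by (metis less_add_one not_less_iff_gr_or_eq)
    show "\<exists>m. ratr m < r \<and> ratr n < ratr m" if "ratr n < r" for n
      using rational_between[OF that] by metis
    show "ratr l < r" if "ratr (left_end K k) < r \<and> ratr l < ratr (right_end K k)" for k l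
      using that r(1) by (force simp: cover_def)
  qed auto
qed

lemma definable_cut_off_cover: "definable (\<lambda>e. cut_off_cover K (e 0))"
  unfolding cut_off_cover_def
  by (intro nat_intros definable_mem_terms definable_term_num_of term_intros definable_ratr_less
      nat_term_left_end nat_term_right_end)

lemma meager_complement_cover:
  assumes "K > 0"
  shows "meager_in E V (- cover K \<inter> reals_of E V)"
proof -
  \<comment> \<open>One nowhere dense set suffices; empty sets complete the sequence.\<close>
  define X where "X n = (if n = 0 then - cover K \<inter> reals_of E V else {})" for n :: nat
  obtain w where w: "w \<in> V" "\<And>z. E z w \<longleftrightarrow> z \<in> range num" using omega_exists by blast
  \<comment> \<open>Reals of the model are sets of numerals, so the wanted cuts can be separated
    from the power set of omega.\<close>
  obtain P where P: "P \<in> V" "\<And>z. z \<in> V \<Longrightarrow> E z P \<longleftrightarrow> (\<forall>y. E y z \<longrightarrow> E y w)"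
    using power_set[OF w(1)] by blast
  from separation[of "\<lambda>x _. cut_off_cover K x", OF definable_cut_off_cover P(1) P(1)]
  obtain A where A: "A \<in> V" "\<And>x. E x A \<longleftrightarrow> E x P \<and> cut_off_cover K x" by blast
  have EA: "E x A \<longleftrightarrow> (\<exists>r\<in>X 0. is_real E r x)" for x
  proof
    assume "E x A"
    then have x: "x \<in> V" "E x P" "cut_off_cover K x" using A by blast+
    then have "z \<in> range num" if "E z x" for z using P(2)[OF x(1)] w(2) that by blast
    with cut_off_cover_iff[OF x(1)] x(3) obtain r where "r \<in> - cover K" "is_real E r x" by blast
    then show "\<exists>r\<in>X 0. is_real E r x" using x(1) by (auto simp: X_def reals_of_def)
  next
    assume "\<exists>r\<in>X 0. is_real E r x"
    then obtain r where r: "r \<in> - cover K" "r \<in> reals_of E V" "is_real E r x"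
      by (auto simp: X_def)
    have x: "x \<in> V" using is_real_in[OF r(3,2)] .
    have sub: "z \<in> range num" if "E z x" for z using r(3) that by (auto simp: is_real_iff)
    then have "E x P" using P(2)[OF x] w(2) by blast
    then show "E x A" using A(2) cut_off_cover_iff[OF x sub] r by blast
  qed
  have "definable_term (\<lambda>e. op (num 0) (e 0))" by (intro term_intros)
  from replacement[OF this A(1)] obtain b
    where b: "b \<in> V" "\<And>z. E z b \<longleftrightarrow> (\<exists>x. E x A \<and> z = op (num 0) x)" by blast
  have "E z b \<longleftrightarrow> (\<exists>n r a x. r \<in> X n \<and> is_numeral E n a \<and> is_real E r x \<and> is_opair E a x z)" for z
  proof -
    have "(\<exists>n r a x. r \<in> X n \<and> is_numeral E n a \<and> is_real E r x \<and> is_opair E a x z) \<longleftrightarrow>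
        (\<exists>x. (\<exists>r\<in>X 0. is_real E r x) \<and> is_opair E (num 0) x z)"
      by (auto simp: is_numeral_iff X_def split: if_splits)
    also have "\<dots> \<longleftrightarrow> (\<exists>x. E x A \<and> z = op (num 0) x)"
      unfolding EA[symmetric] using A(1) is_opair_iff[OF num_in] by blast
    finally show ?thesis using b(2) by simp
  qed
  moreover have "X n \<subseteq> reals_of E V" for n by (simp add: X_def)
  ultimately have "real_set_sequence_in E V X"
    unfolding real_set_sequence_in_def using b(1) by blast
  moreover have "interior (closure (X n)) = {}" for n
    by (rule complement_cover_nowhere_dense[OF assms]) (simp add: X_def)
  moreover have "- cover K \<inter> reals_of E V \<subseteq> (\<Union>n. X n)"
    by (auto simp: X_def)
  ultimately show ?thesis unfolding meager_in_def by blast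
qed

text \<open>The complement of the cover is coded in \<open>V\<close> and meager there, so it
  contains no Cohen real.\<close>

lemma cohen_generic_in_cover:
  assumes "K > 0" "cohen_generic_over E V r"
  shows "r \<in> cover K"
proof (rule ccontr)
  assume "r \<notin> cover K"
  moreover have "function_in E V (complement_code K)"
    by (intro function_in_model nat_term_complement_code)
  ultimately show False
    using assms(2) borel_code_complement_code[of K] meager_complement_cover[OF assms(1)]
    unfolding cohen_generic_over_def cover_def by blast
qed

end

context cohen_extension
begin

lemma cohen_reals_measure_zero:
  "measure_zero_in E VG {r \<in> reals_of E VG. cohen_generic_over E V r}"
  unfolding measure_zero_in_def
proof (intro allI impI)
  fix \<epsilon> :: real
  assume "\<epsilon> > 0"
  \<comment> \<open>The total length of the cover is at most \<open>2 / real K\<close>.\<close>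
  obtain K where "2 / \<epsilon> < real K" using reals_Archimedean2 by blast
  moreover have "0 < 2 / \<epsilon>" using \<open>\<epsilon> > 0\<close> by simp
  ultimately have "real K > 0" by linarith
  with \<open>2 / \<epsilon> < real K\<close> \<open>\<epsilon> > 0\<close> have K: "K > 0" "2 / real K \<le> \<epsilon>"
    by (simp_all add: field_simps)
  show "\<exists>a b. function_in E VG a \<and> function_in E VG b \<and> (\<forall>n. ratr (a n) \<le> ratr (b n)) \<and>
      {r \<in> reals_of E VG. cohen_generic_over E V r} \<subseteq> (\<Union>n. {ratr (a n)<..<ratr (b n)}) \<and>
      (\<forall>N. (\<Sum>n<N. ratr (b n) - ratr (a n)) \<le> \<epsilon>)"
  proof (intro exI conjI allI)
    show "function_in E VG (left_end K)" "function_in E VG (right_end K)"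
      by (intro function_in_extension nat_term_left_end nat_term_right_end; assumption)+
    show "ratr (left_end K n) \<le> ratr (right_end K n)" for n
      using K(1) by (simp add: ratr_left_end ratr_right_end)
    show "{r \<in> reals_of E VG. cohen_generic_over E V r}
        \<subseteq> (\<Union>n. {ratr (left_end K n)<..<ratr (right_end K n)})"
      using cohen_generic_in_cover[OF K(1)] unfolding cover_def by blast
    show "(\<Sum>n<N. ratr (right_end K n) - ratr (left_end K n)) \<le> \<epsilon>" for N
    proof -
      have "2 / real K * (1 - 1 / real (Suc N)) \<le> 2 / real K * 1"
        by (intro mult_left_mono) auto
      then show ?thesis using K by (simp add: sum_interval_lengths del: of_nat_Suc)
    qed
  qed
qed

end

section \<open>A perfect set of Liouville numbers\<close>

text \<open>Digits 1 and 2 instead of 0 and 1 keep every term positive, so no partial sum equals the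
  whole sum and the approximations are never exact.\<close>

definition liouville_term :: "(nat \<Rightarrow> bool) \<Rightarrow> nat \<Rightarrow> real" where
  "liouville_term x k = (if x k then 2 else 1) / 2 ^ fact k"

definition liouville_sum :: "(nat \<Rightarrow> bool) \<Rightarrow> real" where
  "liouville_sum x = (\<Sum>k. liouville_term x k)"

lemma liouville_term_pos: "liouville_term x k > 0"
  by (simp add: liouville_term_def)

text \<open>Domination by a geometric series rests on \<open>n! + i \<le> (i + n)!\<close>, which
  holds for \<open>n > 0\<close> but fails for \<open>n = 0\<close> because
  \<open>0! = 1!\<close>.\<close>

lemma liouville_term_le:
  assumes "n > 0"
  shows "liouville_term x (i + n) \<le> 2 / 2 ^ fact n * (1 / 2) ^ i"
proof -
  have "fact n + i \<le> (fact (i + n) :: nat)"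
  proof (induction i)
    case (Suc i)
    have "(fact (Suc i + n) :: nat) = Suc (i + n) * fact (i + n)" by simp
    moreover have "2 * fact (i + n) \<le> Suc (i + n) * (fact (i + n) :: nat)"
      using assms by (intro mult_le_mono1) simp
    moreover have "(fact (i + n) :: nat) \<ge> 1" by simp
    ultimately show ?case using Suc by linarith
  qed simp
  then have "(2::real) ^ (fact n + i) \<le> 2 ^ fact (i + n)" by (intro power_increasing) auto
  then have "2 / (2::real) ^ fact (i + n) \<le> 2 / 2 ^ (fact n + i)" by (intro divide_left_mono) auto
  moreover have "liouville_term x (i + n) \<le> 2 / 2 ^ fact (i + n)"
    by (simp add: liouville_term_def divide_right_mono)
  ultimately show ?thesis by (simp add: power_add power_divide)
qed

lemma summable_liouville_tail:
  assumes "n > 0"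
  shows "summable (\<lambda>i. liouville_term x (i + n))"
proof (rule summable_comparison_test')
  show "summable (\<lambda>i. 2 / 2 ^ fact n * (1 / 2 :: real) ^ i)"
    by (intro summable_mult summable_geometric) simp
  show "norm (liouville_term x (i + n)) \<le> 2 / 2 ^ fact n * (1 / 2) ^ i" if "i \<ge> 0" for i
    using liouville_term_le[OF assms, of x i] liouville_term_pos[of x "i + n"] by simp
qed

lemma summable_liouville: "summable (liouville_term x)"
  using summable_liouville_tail[of 1 x] summable_iff_shift[of "liouville_term x" 1] by simp

lemma liouville_tail_bounds:
  assumes "n > 0"
  shows "0 < (\<Sum>i. liouville_term x (i + n))" "(\<Sum>i. liouville_term x (i + n)) \<le> 4 / 2 ^ fact n"
proof -
  show "0 < (\<Sum>i. liouville_term x (i + n))"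
    by (rule suminf_pos[OF summable_liouville_tail[OF assms] liouville_term_pos])
  have "(\<Sum>i. liouville_term x (i + n)) \<le> (\<Sum>i. 2 / 2 ^ fact n * (1 / 2 :: real) ^ i)"
    by (intro suminf_le liouville_term_le summable_liouville_tail summable_mult summable_geometric assms)
      simp
  also have "\<dots> = 2 / 2 ^ fact n * (\<Sum>i. (1 / 2 :: real) ^ i)"
    by (intro suminf_mult summable_geometric) simp
  also have "\<dots> = 4 / 2 ^ fact n"
    by (simp add: suminf_geometric)
  finally show "(\<Sum>i. liouville_term x (i + n)) \<le> 4 / 2 ^ fact n" .
qed

lemma liouville_number_sum: "liouville_number (liouville_sum x)"
  unfolding liouville_number_def
proof (intro allI impI)
  fix n :: nat
  assume "n > 0"
  define S where "S = {(p::int, q::int). q > 1 \<and> 0 < \<bar>liouville_sum x - of_int p / of_int q\<bar> \<and>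
      \<bar>liouville_sum x - of_int p / of_int q\<bar> < 1 / of_int q ^ n}"
  \<comment> \<open>\<open>p k\<close> is the numerator of the partial sum through index
    \<open>k\<close> over the common denominator \<open>2 ^ fact k\<close>.\<close>
  define p :: "nat \<Rightarrow> int" where
    "p k = (\<Sum>j<Suc k. (if x j then 2 else 1) * 2 ^ (fact k - fact j))" for k
  have partial: "of_int (p k) / of_int (2 ^ fact k) = (\<Sum>j<Suc k. liouville_term x j)" for k
  proof -
    have "(if x j then 2 else 1) * 2 ^ (fact k - fact j) / 2 ^ fact k = liouville_term x j"
      if "j < Suc k" for j
    proof -
      have "fact j \<le> (fact k :: nat)" using that by (intro fact_mono) simp
      then show ?thesis by (simp add: liouville_term_def power_diff)
    qed
    then show ?thesis
      by (simp add: p_def sum_divide_distrib if_distrib[of of_int] if_distribR cong: if_cong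
          del: sum.lessThan_Suc)
  qed
  \<comment> \<open>From \<open>k \<ge> n + 2\<close> follows
    \<open>(k + 1)! \<ge> (n + 3) * k! \<ge> n * k! + 3\<close>; the spare factor
    \<open>2 ^ 3\<close> absorbs the 4 of the tail bound.\<close>
  have "(p k, 2 ^ fact k) \<in> S" if k: "k \<ge> n + 2" for k
  proof -
    define t where "t = (\<Sum>i. liouville_term x (i + Suc k))"
    have "liouville_sum x = t + (\<Sum>j<Suc k. liouville_term x j)"
      unfolding liouville_sum_def t_def by (rule suminf_split_initial_segment[OF summable_liouville])
    then have diff: "liouville_sum x - of_int (p k) / of_int (2 ^ fact k) = t"
      by (simp only: partial)
    have t: "0 < t" "t \<le> 4 / 2 ^ fact (Suc k)"
      using liouville_tail_bounds[of "Suc k" x] by (simp_all add: t_def)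
    have "(n + 3) * fact k \<le> (fact (Suc k) :: nat)" 
      unfolding fact_Suc of_nat_id by (intro mult_le_mono1) (use k in simp)
    moreover have "(fact k :: nat) \<ge> 1" by simp
    moreover have "(n + 3) * fact k = n * fact k + 3 * (fact k :: nat)" by (rule add_mult_distrib)
    ultimately have "n * fact k + 3 \<le> (fact (Suc k) :: nat)" by linarith
    then have "(2::real) ^ (n * fact k + 3) \<le> 2 ^ fact (Suc k)" by (intro power_increasing) auto
    then have "4 / 2 ^ fact (Suc k) \<le> 4 / (2::real) ^ (n * fact k + 3)"
      by (intro divide_left_mono) auto
    also have "\<dots> < 1 / (2 ^ fact k) ^ n"
      by (simp add: power_add power_mult[symmetric] mult.commute field_simps)
    finally have "t < 1 / (2 ^ fact k) ^ n" using t by linarith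
    moreover have "(2::int) ^ fact k > 1" by (intro one_less_power) auto
    ultimately show ?thesis using t(1) diff by (simp add: S_def)
  qed
  then have "(\<lambda>k. (p k, 2 ^ fact k)) ` {n + 2..} \<subseteq> S" by auto
  \<comment> \<open>The factorial is injective on positive numbers, so different \<open>k\<close>
    give different denominators.\<close>
  moreover have "inj_on (\<lambda>k. (p k, 2 ^ fact k :: int)) {n + 2..}"
  proof (rule inj_onI)
    fix k l assume *: "k \<in> {n + 2..}" "l \<in> {n + 2..}" "(p k, 2 ^ fact k :: int) = (p l, 2 ^ fact l)"
    then have "fact k = (fact l :: nat)" by simp
    then show "k = l" using * fact_less_mono_nat[of k l] fact_less_mono_nat[of l k]
      by (cases k l rule: linorder_cases) auto
  qed
  ultimately show "infinite S"
    using infinite_Ici[of "n + 2"] finite_imageD finite_subset by blast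
qed

text \<open>Tychonoff's theorem for powers of the discrete two-point space.\<close>

lemma compact_UNIV_nat_bool: "compact (UNIV :: (nat \<Rightarrow> bool) set)"
proof -
  have "compact_space (euclidean :: bool topology)"
    by (simp add: compact_space_def compactin_euclidean_iff finite_imp_compact)
  then have "compact_space (product_topology (\<lambda>i::nat. euclidean :: bool topology) UNIV)"
    by (simp add: compact_space_product_topology)
  then show ?thesis
    by (simp add: euclidean_product_topology compact_space_def compactin_euclidean_iff)
qed

lemma continuous_liouville_sum: "continuous_on UNIV liouville_sum"
proof -
  have cont: "continuous_on UNIV (\<lambda>x. liouville_term x k)" for k
  proof -
    have "continuous_on UNIV ((\<lambda>b. (if b then 2 else 1) / 2 ^ fact k :: real) \<circ> (\<lambda>x. x k))"
      by (intro continuous_on_compose continuous_on_product_coordinates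
        Topological_Spaces.continuous_on_discrete)
    then show ?thesis by (simp add: liouville_term_def comp_def)
  qed
  have "uniform_limit UNIV (\<lambda>n x. \<Sum>k<n. liouville_term x k) (\<lambda>x. \<Sum>k. liouville_term x k) sequentially"
    \<comment> \<open>The sequence that is constantly \<open>True\<close> has the largest terms and
      serves as summable majorant.\<close>
    by (rule Weierstrass_m_test[OF _ summable_liouville[of "\<lambda>_. True"]])
      (simp add: liouville_term_def divide_right_mono)
  then have "continuous_on UNIV (\<lambda>x. \<Sum>k. liouville_term x k)"
    by (rule uniform_limit_theorem[rotated])
      (auto intro!: always_eventually continuous_on_sum cont)
  then show ?thesis by (simp add: liouville_sum_def[abs_def])
qed

text \<open>The two series differ in a single summand. The exact distance later shows both that the
  new point is near and that it is different.\<close>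

lemma liouville_sum_flip:
  "\<bar>liouville_sum (x(k := \<not> x k)) - liouville_sum x\<bar> = 1 / 2 ^ fact k"
proof -
  define c :: real where "c = (if x k then - 1 else 1) / 2 ^ fact k"
  have "liouville_sum (x(k := \<not> x k)) - liouville_sum x
      = (\<Sum>i. liouville_term (x(k := \<not> x k)) i - liouville_term x i)"
    unfolding liouville_sum_def by (intro suminf_diff summable_liouville)
  also have "\<dots> = (\<Sum>i. if i = k then c else 0)"
    by (intro suminf_cong) (simp add: liouville_term_def c_def diff_divide_distrib[symmetric])
  also have "\<dots> = c"
    using sums_single[of k "\<lambda>_. c"] by (simp add: sums_iff)
  finally show ?thesis by (simp add: c_def)
qed

lemma perfect_range_liouville_sum: "perfect_set (range liouville_sum)"
  unfolding perfect_set_def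
proof (intro conjI ballI)
  show "closed (range liouville_sum)"
    by (intro compact_imp_closed compact_continuous_image continuous_liouville_sum
        compact_UNIV_nat_bool)
  fix r assume "r \<in> range liouville_sum"
  then obtain x where r: "r = liouville_sum x" by blast
  show "r islimpt range liouville_sum"
    unfolding islimpt_approachable
  proof (intro allI impI)
    fix e :: real assume "e > 0"
    \<comment> \<open>Flipping digit \<open>k\<close> moves the sum by
      \<open>1 / 2 ^ fact k\<close>, which is at most \<open>1 / 2 ^ k\<close>.\<close>
    then obtain k where "(1 / 2) ^ k < e" using real_arch_pow_inv[of e "1 / 2"] by auto
    moreover have "(1 / 2 :: real) ^ fact k \<le> (1 / 2) ^ k"
      by (intro power_decreasing fact_ge_self) auto
    ultimately have "\<bar>liouville_sum (x(k := \<not> x k)) - r\<bar> < e"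
      using liouville_sum_flip[of x k] by (simp add: r power_divide)
    moreover have "liouville_sum (x(k := \<not> x k)) \<noteq> r"
      using liouville_sum_flip[of x k] by (auto simp: r)
    ultimately show "\<exists>r'\<in>range liouville_sum. r' \<noteq> r \<and> dist r' r < e"
      unfolding dist_real_def by blast
  qed
qed simp

theorem corollary4p3:
  shows "(\<forall>(E :: 'u \<Rightarrow> 'u \<Rightarrow> bool) V G VG.
            membership_relation E \<and> transitive_in E V \<and> ZFC_model E V \<and>
            generic_filter E V G \<and> generic_extension E V G VG \<longrightarrow>
              measure_zero_in E VG {r \<in> reals_of E VG. cohen_generic_over E V r}) \<and>
         (\<exists>P. perfect_set P \<and> P \<subseteq> {r. liouville_number r})"
proof (intro conjI allI impI)
  fix E :: "'u \<Rightarrow> 'u \<Rightarrow> bool" and V G VG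
  assume *: "membership_relation E \<and> transitive_in E V \<and> ZFC_model E V \<and>
    generic_filter E V G \<and> generic_extension E V G VG"
  then obtain val where "\<forall>\<tau>\<in>names_of E V. \<forall>y. E y (val \<tau>) \<longleftrightarrow>
      (\<exists>\<sigma> p z. E z \<tau> \<and> is_opair E \<sigma> p z \<and> p \<in> G \<and> y = val \<sigma>)" "VG = val ` names_of E V"
    unfolding generic_extension_def by blast
  with * interpret cohen_extension E V G VG val
    by unfold_locales auto
  show "measure_zero_in E VG {r \<in> reals_of E VG. cohen_generic_over E V r}"
    by (rule cohen_reals_measure_zero)
next
  show "\<exists>P. perfect_set P \<and> P \<subseteq> {r. liouville_number r}"
    using perfect_range_liouville_sum liouville_number_sum by blast
qed

end
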